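(* Let $n\geq 3$. Let $\mathcal{X}_3\subset S_n=\mathrm{SL}(n,\mathbb{R})/\mathrm{SO}(n)$ be the set of lattices in $\mathbb{R}^n$ whose systoles (minimal vectors) generate a subspace of dimension at least $3$. Then $\mathcal{X}_3$ does not contain any model for $\underline{E}\mathrm{Aut}(\mathrm{SL}(n,\mathbb{Z}))$; that is, no $\mathrm{Aut}(\mathrm{SL}(n,\mathbb{Z}))$-invariant subspace $W\subset\mathcal{X}_3$ is a model for $\underline{E}\mathrm{Aut}(\mathrm{SL}(n,\mathbb{Z}))$.
   Context: Models for $\underline{E}\Gamma$: for an infinite discrete group $\Gamma$, a model for $\underline{E}\Gamma$ (classifying space for proper actions) is a $\Gamma$-CW-complex $W$ such that for every subgroup $H\subset\Gamma$ the fixed point set $W^H$ is contractible (in particular non-empty) if $H$ is finite, and empty if $H$ is infinite. Space of lattices: $S_n=\mathrm{SL}(n,\mathbb{R})/\mathrm{SO}(n)$ is identified with the space of covolume $1$ lattices $\Lambda=A\mathbb{Z}^n$ in $\mathbb{R}^n$, $A\in\mathrm{SL}(n,\mathbb{R})$, endowed with the $\mathbb{Z}$-basis given by the columns of $A$, modulo isometries (i.e. $A$ is taken modulo left multiplication by $\mathrm{SO}(n)$); the coset $h\,\mathrm{SO}(n)$ corresponds to the class of $A=h^{-1}$. Equivalently, a point of $S_n$ is the positive definite symmetric matrix $Q={}^tAA$ of determinant $1$. Systoles: for $\Lambda=A\mathbb{Z}^n$, $\mathrm{syst}(\Lambda)=\min_{v\in\mathbb{Z}^n\setminus\{0\}}|Av|$,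 with $|\cdot|$ the Euclidean norm. The vectors $v$ realizing this minimum are called the systoles, or minimal vectors, of $\Lambda$. The dimension of the subspace they generate depends only on the point of $S_n$. Action of $\mathrm{Aut}(\mathrm{SL}(n,\mathbb{Z}))$: for $n\geq 3$, the group $\mathrm{Aut}(\mathrm{SL}(n,\mathbb{Z}))$ is generated by the inner automorphisms (forming a group isomorphic to $\mathrm{PSL}(n,\mathbb{Z})$), the conjugation by the diagonal matrix with entries $(-1,1,\dots,1)$, and the automorphism $\sigma(X)=({}^tX)^{-1}$. The usual action of $\mathrm{PSL}(n,\mathbb{Z})$ on $S_n$ by left translations extends to an isometric action of $\mathrm{Aut}(\mathrm{SL}(n,\mathbb{Z}))$ on $S_n$: in terms of $Q$, the conjugation $X\mapsto\gamma X\gamma^{-1}$ with $\gamma\in\mathrm{GL}(n,\mathbb{Z})$ acts by $Q\mapsto{}^t\gamma^{-1}Q\gamma^{-1}$, and $\sigma$ acts by $Q\mapsto Q^{-1}$. This is the action considered. *)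

theory Defs
  imports
    "HOL-Analysis.Analysis"
    "HOL-Algebra.Bij"
    "HOL-Algebra.Group_Action"
    "HOL-Algebra.Left_Coset"
begin

section \<open>Equivariant CW complexes and classifying spaces for proper actions\<close>

text \<open>The group is discrete and is given by its carrier; only the restriction of \<open>\<rho> g\<close> to the
  space is relevant.\<close>

definition group_space ::
    "('g, 'm) monoid_scheme \<Rightarrow> ('g \<Rightarrow> 'a \<Rightarrow> 'a) \<Rightarrow> 'a topology \<Rightarrow> bool" where
  "group_space G \<rho> T \<longleftrightarrow>
     group_action G (topspace T) (\<lambda>g. restrict (\<rho> g) (topspace T)) \<and>
     (\<forall>g\<in>carrier G. continuous_map T T (\<rho> g))"

text \<open>The closed disc of dimension \<open>n\<close> and its boundary, as subspaces of \<open>\<real>\<^sup>n\<close> for a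
  natural number \<open>n\<close>. For \<open>n = 0\<close> the disc is a point and the boundary is empty.\<close>

definition disc :: "nat \<Rightarrow> (nat \<Rightarrow> real) topology" where
  "disc n = subtopology (Euclidean_space n) {x. (\<Sum>i<n. (x i)\<^sup>2) \<le> 1}"

definition disc_boundary :: "nat \<Rightarrow> (nat \<Rightarrow> real) set" where
  "disc_boundary n = {x \<in> topspace (disc n). (\<Sum>i<n. (x i)\<^sup>2) = 1}"

definition equivariant_cell ::
    "('g, 'm) monoid_scheme \<Rightarrow> 'g set \<Rightarrow> nat \<Rightarrow> ('g set \<times> (nat \<Rightarrow> real)) topology" where
  "equivariant_cell G H n = prod_topology (discrete_topology (lcosets\<^bsub>G\<^esub> H)) (disc n)"

text \<open>The square with corners \<open>\<Coprod> G/H \<times> S\<^sup>n\<^sup>-\<^sup>1\<close>, \<open>Y\<close>, \<open>\<Coprod> G/H \<times> D\<^sup>n\<close>, \<open>Z\<close> is a pushout of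
  \<open>G\<close>-spaces, where \<open>Y\<close> and \<open>Z\<close> carry the topology induced from \<open>T\<close>. The cells are indexed by
  the set \<open>C\<close> of pairs of an isotropy group \<open>H\<close> and a characteristic map \<open>\<Phi>\<close>; no generality is
  lost by this indexing, as different cells have disjoint nonempty interiors and hence different
  characteristic maps.\<close>

definition attaches_equivariant_cells ::
    "('g, 'm) monoid_scheme \<Rightarrow> ('g \<Rightarrow> 'a \<Rightarrow> 'a) \<Rightarrow> 'a topology \<Rightarrow> nat \<Rightarrow> 'a set \<Rightarrow> 'a set \<Rightarrow>
     ('g set \<times> ('g set \<times> (nat \<Rightarrow> real) \<Rightarrow> 'a)) set \<Rightarrow> bool" where
  "attaches_equivariant_cells G \<rho> T n Y Z C \<longleftrightarrow>
     Y \<subseteq> Z \<and>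
     (\<forall>(H, \<Phi>)\<in>C.
        subgroup H G \<and>
        continuous_map (equivariant_cell G H n) (subtopology T Z) \<Phi> \<and>
        (\<forall>g\<in>carrier G. \<forall>c\<in>lcosets\<^bsub>G\<^esub> H. \<forall>x\<in>topspace (disc n).
           \<Phi> (g <#\<^bsub>G\<^esub> c, x) = \<rho> g (\<Phi> (c, x))) \<and>
        \<Phi> ` ((lcosets\<^bsub>G\<^esub> H) \<times> disc_boundary n) \<subseteq> Y) \<and>
     bij_betw (\<lambda>((H, \<Phi>), p). \<Phi> p)
       (SIGMA (H, \<Phi>):C. (lcosets\<^bsub>G\<^esub> H) \<times> (topspace (disc n) - disc_boundary n)) (Z - Y) \<and>
     (\<forall>A\<subseteq>Z. closedin (subtopology T Z) A \<longleftrightarrow>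
        closedin (subtopology T Y) (A \<inter> Y) \<and>
        (\<forall>(H, \<Phi>)\<in>C. closedin (equivariant_cell G H n)
           {p \<in> topspace (equivariant_cell G H n). \<Phi> p \<in> A}))"

text \<open>Here \<open>X n\<close> is the skeleton of dimension \<open>n - 1\<close>, so that \<open>X 0\<close> is the empty skeleton.\<close>

definition equivariant_CW_complex ::
    "('g, 'm) monoid_scheme \<Rightarrow> ('g \<Rightarrow> 'a \<Rightarrow> 'a) \<Rightarrow> 'a topology \<Rightarrow> bool" where
  "equivariant_CW_complex G \<rho> T \<longleftrightarrow>
     group_space G \<rho> T \<and>
     (\<exists>X C.
        X 0 = {} \<and>
        (\<forall>n. attaches_equivariant_cells G \<rho> T n (X n) (X (Suc n)) (C n)) \<and>
        (\<Union>n. X n) = topspace T \<and>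
        (\<forall>A\<subseteq>topspace T.
           closedin T A \<longleftrightarrow> (\<forall>n. closedin (subtopology T (X n)) (A \<inter> X n))))"

definition fixed_points :: "('g \<Rightarrow> 'a \<Rightarrow> 'a) \<Rightarrow> 'a topology \<Rightarrow> 'g set \<Rightarrow> 'a set" where
  "fixed_points \<rho> T H = {x \<in> topspace T. \<forall>h\<in>H. \<rho> h x = x}"

text \<open>The empty space satisfies \<^const>\<open>contractible_space\<close>, so nonemptiness is required
  separately.\<close>

definition is_model_for_EG ::
    "('g, 'm) monoid_scheme \<Rightarrow> ('g \<Rightarrow> 'a \<Rightarrow> 'a) \<Rightarrow> 'a topology \<Rightarrow> bool" where
  "is_model_for_EG G \<rho> T \<longleftrightarrow>
     equivariant_CW_complex G \<rho> T \<and>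
     (\<forall>H. subgroup H G \<longrightarrow>
        (if finite H
         then fixed_points \<rho> T H \<noteq> {} \<and>
              contractible_space (subtopology T (fixed_points \<rho> T H))
         else fixed_points \<rho> T H = {}))"

section \<open>The space of lattices and the systoles\<close>

text \<open>The class of the lattice \<open>A \<int>\<^sup>n\<close> with its marking, for \<open>A\<close> modulo left multiplication by
  \<open>SO(n)\<close>, is represented by the matrix \<open>Q = \<^sup>tA A\<close>.\<close>

definition gram :: "real^'n^'n \<Rightarrow> real^'n^'n" where
  "gram A = transpose A ** A"

definition lattice_space :: "(real^'n^'n) set" where
  "lattice_space = gram ` {A. det A = 1}"

definition real_vec :: "int^'n \<Rightarrow> real^'n" where
  "real_vec v = (\<chi> i. of_int (v $ i))"

definition systoles :: "real^'n^'n \<Rightarrow> (int^'n) set" where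
  "systoles A = {v. is_arg_min (\<lambda>w. norm (A *v real_vec w)) (\<lambda>w. w \<noteq> 0) v}"

definition lattices_with_systole_rank_ge :: "nat \<Rightarrow> (real^'n^'n) set" where
  "lattices_with_systole_rank_ge k =
     gram ` {A. det A = 1 \<and> k \<le> dim (real_vec ` systoles A)}"

lemma gram_eq_iff:
  fixes A B :: "real^'n^'n"
  assumes "det A = 1" "det B = 1"
  shows "gram A = gram B \<longleftrightarrow> (\<exists>R. orthogonal_matrix R \<and> det R = 1 \<and> B = R ** A)"
proof
  assume eq: "gram A = gram B"
  obtain A' where A': "A ** A' = mat 1" "A' ** A = mat 1"
    using assms(1) invertible_det_nz[of A] unfolding invertible_def by auto
  define R where "R = B ** A'"
  have RA: "R ** A = B"
    by (simp add: R_def A' flip: matrix_mul_assoc)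
  have "transpose R ** R = transpose A' ** (transpose B ** B) ** A'"
    by (simp add: R_def matrix_transpose_mul matrix_mul_assoc)
  also have "\<dots> = transpose A' ** (transpose A ** A) ** A'"
    using eq by (simp add: gram_def)
  also have "\<dots> = transpose (A ** A') ** (A ** A')"
    by (simp add: matrix_transpose_mul matrix_mul_assoc)
  finally have "orthogonal_matrix R"
    by (simp add: A' orthogonal_matrix)
  moreover have "det R = 1"
    using arg_cong[OF RA, of det] assms by (simp add: det_mul)
  ultimately show "\<exists>R. orthogonal_matrix R \<and> det R = 1 \<and> B = R ** A"
    using RA by blast
next
  assume "\<exists>R. orthogonal_matrix R \<and> det R = 1 \<and> B = R ** A"
  then obtain R where R: "transpose R ** R = mat 1" "B = R ** A"
    by (auto simp: orthogonal_matrix)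
  have "gram B = transpose A ** (transpose R ** R) ** A"
    by (simp add: gram_def R(2) matrix_transpose_mul matrix_mul_assoc)
  then show "gram A = gram B"
    by (simp add: R gram_def)
qed

lemma systoles_cong:
  fixes A B :: "real^'n^'n"
  assumes "gram A = gram B"
  shows "systoles A = systoles B"
proof -
  have *: "(norm (A *v x))\<^sup>2 = x \<bullet> (gram A *v x)" for A :: "real^'n^'n" and x :: "real^'n"
    by (simp add: gram_def power2_norm_eq_inner dot_lmul_matrix inner_commute
        flip: matrix_vector_mul_assoc)
      (metis dot_lmul_matrix inner_commute vector_transpose_matrix)
  have "norm (A *v x) = norm (B *v x)" for x :: "real^'n"
    by (rule power2_eq_imp_eq) (simp_all add: * assms)
  then show ?thesis by (simp add: systoles_def)
qed

section \<open>The action of the automorphism group\<close>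

definition SL_int :: "(int^'n^'n) monoid" where
  "SL_int = \<lparr>carrier = {A. det A = 1}, mult = (**), one = mat 1\<rparr>"

definition conj_aut :: "int^'n^'n \<Rightarrow> int^'n^'n \<Rightarrow> int^'n^'n" where
  "conj_aut \<gamma> = (\<lambda>X\<in>carrier SL_int. \<gamma> ** X ** matrix_inv \<gamma>)"

definition sigma_aut :: "int^'n^'n \<Rightarrow> int^'n^'n" where
  "sigma_aut = (\<lambda>X\<in>carrier SL_int. matrix_inv (transpose X))"

definition conj_act :: "int^'n^'n \<Rightarrow> real^'n^'n \<Rightarrow> real^'n^'n" where
  "conj_act \<gamma> Q =
     transpose (map_matrix of_int (matrix_inv \<gamma>)) ** Q ** map_matrix of_int (matrix_inv \<gamma>)"

text \<open>For \<open>n \<ge> 3\<close> the conjugations by \<open>\<gamma> \<in> GL(n,\<int>)\<close> and \<open>\<sigma>\<close> generate the automorphism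
  group. As \<open>\<sigma> \<circ> conj \<gamma> = conj (\<^sup>t\<gamma>\<^sup>-\<^sup>1) \<circ> \<sigma>\<close> and \<open>\<sigma>\<^sup>2 = 1\<close>, every automorphism is of the form
  \<open>conj \<gamma>\<close> or \<open>conj \<gamma> \<circ> \<sigma>\<close>. The first acts by \<open>Q \<mapsto> \<^sup>t\<gamma>\<^sup>-\<^sup>1 Q \<gamma>\<^sup>-\<^sup>1\<close> and the second by
  \<open>Q \<mapsto> \<^sup>t\<gamma>\<^sup>-\<^sup>1 Q\<^sup>-\<^sup>1 \<gamma>\<^sup>-\<^sup>1\<close>; the lemmas below show that the description is unambiguous.\<close>

definition aut_act :: "(int^'n^'n \<Rightarrow> int^'n^'n) \<Rightarrow> real^'n^'n \<Rightarrow> real^'n^'n" where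
  "aut_act \<phi> Q = (THE Q'. \<exists>\<gamma>. invertible \<gamma> \<and>
     (\<phi> = conj_aut \<gamma> \<and> Q' = conj_act \<gamma> Q \<or>
      \<phi> = compose (carrier SL_int) (conj_aut \<gamma>) sigma_aut \<and> Q' = conj_act \<gamma> (matrix_inv Q)))"

definition unit_mat :: "'n \<Rightarrow> 'n \<Rightarrow> int^'n^'n" where
  "unit_mat i j = (\<chi> a b. if a = i \<and> b = j then 1 else 0)"

lemma unit_mat_mult_left: "(unit_mat i j ** M) $ a $ b = (if a = i then M $ j $ b else 0)"
  by (simp add: unit_mat_def matrix_matrix_mult_def if_distrib[where f="\<lambda>x. x * _"] cong: if_cong)

lemma unit_mat_mult_right: "(M ** unit_mat i j) $ a $ b = (if b = j then M $ a $ i else 0)"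
  by (simp add: unit_mat_def matrix_matrix_mult_def if_distrib[where f="\<lambda>x. _ * x"] cong: if_cong)

lemma int_matrix_diff_mult: "(A - B) ** C = A ** C - B ** C" for A :: "int^'n^'n"
  by (simp add: matrix_matrix_mult_def vec_eq_iff left_diff_distrib sum_subtractf)

lemma int_matrix_mult_diff: "A ** (B - C) = A ** B - A ** C" for A :: "int^'n^'n"
  by (simp add: matrix_matrix_mult_def vec_eq_iff right_diff_distrib sum_subtractf)

lemma int_matrix_add_mult: "(A + B) ** C = A ** C + B ** C" for A :: "int^'n^'n"
  by (simp add: matrix_matrix_mult_def vec_eq_iff distrib_right sum.distrib)

lemma unit_mat_square: "i \<noteq> j \<Longrightarrow> unit_mat i j ** unit_mat i j = 0"
  by (simp add: vec_eq_iff unit_mat_mult_left) (simp add: unit_mat_def)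

lemma unit_mat_inverse:
  assumes "i \<noteq> j"
  shows "(mat 1 + unit_mat i j) ** (mat 1 - unit_mat i j) = mat 1"
    "(mat 1 - unit_mat i j) ** (mat 1 + unit_mat i j) = mat 1"
  using unit_mat_square[OF assms]
  by (simp_all add: matrix_add_ldistrib int_matrix_add_mult int_matrix_diff_mult int_matrix_mult_diff)

lemma matrix_inv_eqI:
  fixes A :: "'a::semiring_1^'n^'n"
  assumes "A ** B = mat 1" "B ** A = mat 1"
  shows "matrix_inv A = B"
proof -
  have "A ** matrix_inv A = mat 1 \<and> matrix_inv A ** A = mat 1"
    unfolding matrix_inv_def by (rule someI[of _ B]) (use assms in auto)
  moreover have "B ** (A ** matrix_inv A) = matrix_inv A"
    by (simp add: matrix_mul_assoc assms)
  ultimately show ?thesis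
    by simp
qed

lemma matrix_inv_mult:
  fixes A :: "'a::semiring_1^'n^'n"
  assumes "invertible A"
  shows "A ** matrix_inv A = mat 1" "matrix_inv A ** A = mat 1"
  using assms unfolding invertible_def by (auto dest: matrix_inv_eqI)

lemma det_map_of_int: "det (map_matrix real_of_int A) = of_int (det A)" for A :: "int^'n^'n"
  by (simp add: det_def)

lemma map_of_int_mult:
  "map_matrix real_of_int (A ** B) = map_matrix real_of_int A ** map_matrix real_of_int B"
  for A B :: "int^'n^'n"
  by (simp add: vec_eq_iff matrix_matrix_mult_def)

lemma map_of_int_eq_iff: "map_matrix real_of_int A = map_matrix real_of_int B \<longleftrightarrow> A = B"
  for A B :: "int^'n^'n"
  by (simp add: vec_eq_iff)

lemma map_of_int_mat_1: "map_matrix real_of_int (mat 1) = mat 1"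
  by (simp add: vec_eq_iff mat_def)

lemma SL_int_invertible:
  fixes X :: "int^'n^'n"
  assumes "det X = 1"
  shows "invertible X"
proof -
  let ?R = "map_matrix real_of_int"
  define Y :: "int^'n^'n" where
    "Y = (\<chi> k j. det (\<chi> i l. if l = k then (if i = j then 1 else 0) else X $ i $ l))"
  have dX: "det (?R X) = 1"
    by (simp add: det_map_of_int assms)
  have "?R X *v column j (?R Y) = (\<chi> i. if i = j then 1 else 0)" (is "_ = ?b") for j
  proof -
    have "?R (\<chi> i l. if l = k then (if i = j then 1 else 0) else X $ i $ l)
        = (\<chi> i l. if l = k then ?b $ i else ?R X $ i $ l)" for k
      by (simp add: vec_eq_iff)
    then have "column j (?R Y) = (\<chi> k. det (\<chi> i l. if l = k then ?b $ i else ?R X $ i $ l) / det (?R X))"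
      unfolding dX by (simp add: column_def Y_def flip: det_map_of_int)
    then show ?thesis
      using cramer[of "?R X" "column j (?R Y)" ?b] dX by simp
  qed
  then have "?R X ** ?R Y = mat 1"
    by (simp add: vec_eq_iff matrix_matrix_mult_def matrix_vector_mult_def column_def mat_def)
  moreover from this have "?R Y ** ?R X = mat 1"
    by (simp add: matrix_left_right_inverse)
  ultimately have "?R (X ** Y) = ?R (mat 1)" "?R (Y ** X) = ?R (mat 1)"
    by (simp_all only: map_of_int_mult map_of_int_mat_1)
  then show ?thesis
    unfolding map_of_int_eq_iff invertible_def by blast
qed

lemma SL_int_inv_closed:
  fixes X :: "int^'n^'n"
  assumes "det X = 1"
  shows "det (matrix_inv X) = 1"
proof -
  have "det X * det (matrix_inv X) = 1"
    using matrix_inv_mult[OF SL_int_invertible[OF assms]] by (metis det_I det_mul)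
  then show ?thesis using assms by simp
qed

lemma group_SL_int: "group SL_int"
proof (rule groupI)
  fix X :: "int^'n^'n" assume X: "X \<in> carrier SL_int"
  show "\<exists>Y\<in>carrier SL_int. Y \<otimes>\<^bsub>SL_int\<^esub> X = \<one>\<^bsub>SL_int\<^esub>"
    using X by (intro bexI[of _ "matrix_inv X"])
      (auto simp: SL_int_def SL_int_inv_closed SL_int_invertible matrix_inv_mult)
qed (auto simp: SL_int_def det_mul matrix_mul_assoc)

lemma elementary_in_SL_int:
  fixes i j :: "'n::finite"
  assumes "i \<noteq> j"
  shows "mat 1 + unit_mat i j \<in> (carrier SL_int :: (int^'n^'n) set)"
proof -
  let ?I = "mat 1 :: real^'n^'n"
  have eq: "(\<chi> k. if k = i then row i ?I + 1 *s row j ?I else row k ?I)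
      = map_matrix real_of_int (mat 1 + unit_mat i j)"
    using assms by (auto simp: vec_eq_iff unit_mat_def row_def mat_def)
  have "det (map_matrix real_of_int (mat 1 + unit_mat i j)) = 1"
    using det_row_operation[OF assms, of ?I 1] by (simp add: eq)
  then have "det (mat 1 + unit_mat i j) = 1"
    by (simp add: det_map_of_int)
  then show ?thesis by (simp add: SL_int_def)
qed

lemma sigma_aut_elementary:
  assumes "i \<noteq> j"
  shows "sigma_aut (mat 1 + unit_mat i j) = mat 1 - unit_mat j i"
proof -
  have "transpose (mat 1 + unit_mat i j) = mat 1 + unit_mat j i"
    by (auto simp: vec_eq_iff transpose_def unit_mat_def mat_def)
  then show ?thesis
    using assms unit_mat_inverse[of j i]
    by (simp add: sigma_aut_def elementary_in_SL_int matrix_inv_eqI)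
qed

lemma conj_aut_commute:
  fixes \<gamma> \<gamma>' X Y :: "int^'n^'n"
  assumes "invertible \<gamma>" "invertible \<gamma>'" "\<gamma> ** X ** matrix_inv \<gamma> = \<gamma>' ** Y ** matrix_inv \<gamma>'"
  shows "(matrix_inv \<gamma>' ** \<gamma>) ** X = Y ** (matrix_inv \<gamma>' ** \<gamma>)"
proof -
  note inv = matrix_inv_mult[OF assms(1)] matrix_inv_mult[OF assms(2)]
  have "(matrix_inv \<gamma>' ** \<gamma>) ** X = matrix_inv \<gamma>' ** (\<gamma> ** X ** (matrix_inv \<gamma> ** \<gamma>))"
    by (simp add: inv matrix_mul_assoc)
  also have "\<dots> = matrix_inv \<gamma>' ** (\<gamma> ** X ** matrix_inv \<gamma>) ** \<gamma>"
    by (simp only: matrix_mul_assoc)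
  also have "\<dots> = (matrix_inv \<gamma>' ** \<gamma>') ** Y ** (matrix_inv \<gamma>' ** \<gamma>)"
    by (simp only: assms(3) matrix_mul_assoc)
  finally show ?thesis by (simp add: inv)
qed

lemma conj_aut_eqD:
  fixes \<gamma> \<gamma>' :: "int^'n^'n"
  assumes inv: "invertible \<gamma>" "invertible \<gamma>'"
    and eq: "\<And>i j. i \<noteq> j \<Longrightarrow> \<gamma> ** (mat 1 + unit_mat i j) ** matrix_inv \<gamma>
                                = \<gamma>' ** (mat 1 + unit_mat i j) ** matrix_inv \<gamma>'"
    and card: "3 \<le> CARD('n)"
  shows "conj_act \<gamma> = conj_act \<gamma>'"
proof -
  define \<delta> where "\<delta> = matrix_inv \<gamma>' ** \<gamma>"
  have com: "\<delta> ** unit_mat i j = unit_mat i j ** \<delta>" if "i \<noteq> j" for i j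
    using conj_aut_commute[OF inv eq[OF that]]
    by (simp add: \<delta>_def matrix_add_ldistrib int_matrix_add_mult)
  have ex: "\<exists>j. j \<noteq> i" for i :: 'n
  proof (rule ccontr)
    assume "\<nexists>j. j \<noteq> i"
    then have "(UNIV :: 'n set) = {i}" by auto
    then have "CARD('n) = card {i}" by (rule arg_cong)
    then show False using card by simp
  qed
  have off: "\<delta> $ a $ i = 0" if "a \<noteq> i" for a i
  proof -
    obtain j where "j \<noteq> i" using ex by blast
    then show ?thesis
      using com[of i j] that
      by (metis unit_mat_mult_left unit_mat_mult_right)
  qed
  have diag: "\<delta> $ i $ i = \<delta> $ j $ j" for i j
  proof (cases "i = j")
    case False
    then show ?thesis
      using arg_cong[OF com[OF False], of "\<lambda>M. M $ i $ j"]
      by (simp add: unit_mat_mult_left unit_mat_mult_right)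
  qed simp
  obtain i0 :: 'n where True by simp
  define c where "c = \<delta> $ i0 $ i0"
  have \<delta>: "\<delta> = mat c"
    using off diag by (auto simp: vec_eq_iff mat_def c_def)
  have "\<gamma>' ** \<delta> = \<gamma>"
    by (simp add: \<delta>_def matrix_mul_assoc matrix_inv_mult inv)
  then have g: "\<gamma> $ a $ b = \<gamma>' $ a $ b * c" for a b
    unfolding \<delta> by (auto simp: matrix_matrix_mult_def mat_def if_distrib[where f="\<lambda>x. _ * x"]
      cong: if_cong)
  have "(matrix_inv \<gamma> ** \<gamma>') ** \<delta> = matrix_inv \<gamma> ** (\<gamma>' ** \<delta>)"
    by (simp add: matrix_mul_assoc)
  then have "(matrix_inv \<gamma> ** \<gamma>') ** mat c = mat 1"
    using \<open>\<gamma>' ** \<delta> = \<gamma>\<close> inv by (simp add: matrix_inv_mult \<delta>)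
  then have "((matrix_inv \<gamma> ** \<gamma>') ** mat c) $ i0 $ i0 = 1"
    by (simp add: mat_def)
  then have "(matrix_inv \<gamma> ** \<gamma>') $ i0 $ i0 * c = 1"
    by (simp add: matrix_matrix_mult_def[of "matrix_inv \<gamma> ** \<gamma>'"] mat_def if_distrib[where f="\<lambda>x. _ * x"]
      cong: if_cong)
  then have c: "c = 1 \<or> c = -1"
    using zmult_eq_1_iff by auto
  then consider "\<gamma> = \<gamma>'" | "\<gamma> = - \<gamma>'"
    using g by (fastforce simp: vec_eq_iff)
  then show ?thesis
  proof cases
    case 2
    have "matrix_inv \<gamma> = - matrix_inv \<gamma>'"
      unfolding 2
    proof (rule matrix_inv_eqI)
      have *: "(- A) ** (- B) = A ** B" for A B :: "int^'n^'n"
        by (simp add: matrix_matrix_mult_def)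
      show "- \<gamma>' ** - matrix_inv \<gamma>' = mat 1" "- matrix_inv \<gamma>' ** - \<gamma>' = mat 1"
        using inv by (simp_all add: * matrix_inv_mult)
    qed
    then show ?thesis
      by (simp add: fun_eq_iff conj_act_def vec_eq_iff matrix_matrix_mult_def transpose_def sum_negf)
  qed simp
qed

lemma conj_aut_neq_sigma:
  fixes \<gamma> \<gamma>' :: "int^'n^'n"
  assumes inv: "invertible \<gamma>" "invertible \<gamma>'"
    and card: "3 \<le> CARD('n)"
  shows "conj_aut \<gamma> \<noteq> compose (carrier SL_int) (conj_aut \<gamma>') sigma_aut"
proof
  assume eq: "conj_aut \<gamma> = compose (carrier SL_int) (conj_aut \<gamma>') sigma_aut"
  define \<delta> where "\<delta> = matrix_inv \<gamma>' ** \<gamma>"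
  have com: "\<delta> ** unit_mat i j = - (unit_mat j i ** \<delta>)" if "i \<noteq> j" for i j
  proof -
    have "mat 1 - unit_mat j i \<in> carrier SL_int"
    proof -
      have "det (mat 1 - unit_mat j i) * det (mat 1 + unit_mat j i) = 1"
        using that unit_mat_inverse(2)[of j i] by (metis det_I det_mul)
      then show ?thesis
        using elementary_in_SL_int[of j i] that by (simp add: SL_int_def)
    qed
    then have "\<gamma> ** (mat 1 + unit_mat i j) ** matrix_inv \<gamma>
             = \<gamma>' ** (mat 1 - unit_mat j i) ** matrix_inv \<gamma>'"
      using fun_cong[OF eq, of "mat 1 + unit_mat i j"] that
      by (simp add: conj_aut_def compose_def elementary_in_SL_int sigma_aut_elementary)
    from conj_aut_commute[OF inv this] show ?thesis
      by (simp add: \<delta>_def matrix_add_ldistrib int_matrix_diff_mult)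
  qed
  have zero: "\<delta> $ a $ i = 0" for a i
  proof -
    have "(UNIV :: 'n set) \<noteq> {a, i}"
    proof
      assume "(UNIV :: 'n set) = {a, i}"
      then have "CARD('n) = card {a, i}" by (rule arg_cong)
      also have "\<dots> \<le> 2" by (simp add: card_insert_if)
      finally show False using card by simp
    qed
    then obtain j where "j \<noteq> a" "j \<noteq> i" by blast
    then show ?thesis
      using arg_cong[OF com[of i j], of "\<lambda>M. M $ a $ j"]
      by (simp add: unit_mat_mult_left unit_mat_mult_right)
  qed
  have "\<gamma> = \<gamma>' ** \<delta>"
    by (simp add: \<delta>_def matrix_mul_assoc matrix_inv_mult inv)
  then have "\<gamma> = 0"
    using zero by (simp add: vec_eq_iff matrix_matrix_mult_def)
  then have "mat 1 = (0 :: int^'n^'n)"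
    using matrix_inv_mult(1)[OF inv(1)] by simp
  then have "(mat 1 :: int^'n^'n) $ i $ i = 0" for i
    by simp
  then show False
    by (simp add: mat_def)
qed

lemma aut_act_conj_aut:
  fixes \<gamma> :: "int^'n^'n"
  assumes "invertible \<gamma>" "3 \<le> CARD('n)"
  shows "aut_act (conj_aut \<gamma>) Q = conj_act \<gamma> Q"
  unfolding aut_act_def
proof (rule the_equality)
  fix Q'
  assume "\<exists>\<gamma>'. invertible \<gamma>' \<and>
     (conj_aut \<gamma> = conj_aut \<gamma>' \<and> Q' = conj_act \<gamma>' Q \<or>
      conj_aut \<gamma> = compose (carrier SL_int) (conj_aut \<gamma>') sigma_aut \<and>
      Q' = conj_act \<gamma>' (matrix_inv Q))"
  then obtain \<gamma>' where \<gamma>': "invertible \<gamma>'" "conj_aut \<gamma> = conj_aut \<gamma>'" "Q' = conj_act \<gamma>' Q"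
    using conj_aut_neq_sigma assms by blast
  have "conj_act \<gamma> = conj_act \<gamma>'"
  proof (rule conj_aut_eqD)
    fix i j :: 'n assume "i \<noteq> j"
    then show "\<gamma> ** (mat 1 + unit_mat i j) ** matrix_inv \<gamma>
             = \<gamma>' ** (mat 1 + unit_mat i j) ** matrix_inv \<gamma>'"
      using fun_cong[OF \<gamma>'(2), of "mat 1 + unit_mat i j"]
      by (simp add: conj_aut_def elementary_in_SL_int)
  qed (use assms \<gamma>' in auto)
  then show "Q' = conj_act \<gamma> Q" using \<gamma>' by simp
qed (use assms in auto)

lemma aut_act_conj_aut_sigma:
  fixes \<gamma> :: "int^'n^'n"
  assumes "invertible \<gamma>" "3 \<le> CARD('n)"
  shows "aut_act (compose (carrier SL_int) (conj_aut \<gamma>) sigma_aut) Q = conj_act \<gamma> (matrix_inv Q)"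
  unfolding aut_act_def
proof (rule the_equality)
  fix Q'
  let ?s = "\<lambda>\<gamma>. compose (carrier SL_int) (conj_aut \<gamma>) sigma_aut"
  assume "\<exists>\<gamma>'. invertible \<gamma>' \<and>
     (?s \<gamma> = conj_aut \<gamma>' \<and> Q' = conj_act \<gamma>' Q \<or>
      ?s \<gamma> = ?s \<gamma>' \<and> Q' = conj_act \<gamma>' (matrix_inv Q))"
  then obtain \<gamma>' where \<gamma>': "invertible \<gamma>'" "?s \<gamma> = ?s \<gamma>'" "Q' = conj_act \<gamma>' (matrix_inv Q)"
    using conj_aut_neq_sigma assms by metis
  have "conj_act \<gamma> = conj_act \<gamma>'"
  proof (rule conj_aut_eqD)
    fix i j :: 'n assume ij: "i \<noteq> j"
    let ?F = "mat 1 - unit_mat i j"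
    have F: "?F \<in> carrier SL_int"
    proof -
      have "det ?F * det (mat 1 + unit_mat i j) = 1"
        using unit_mat_inverse(2)[OF ij] by (metis det_I det_mul)
      then show ?thesis
        using elementary_in_SL_int[OF ij] by (simp add: SL_int_def)
    qed
    have com: "\<gamma> ** ?F ** matrix_inv \<gamma> = \<gamma>' ** ?F ** matrix_inv \<gamma>'"
      using fun_cong[OF \<gamma>'(2), of "mat 1 + unit_mat j i"] ij F
      by (simp add: conj_aut_def compose_def elementary_in_SL_int sigma_aut_elementary)
    let ?I = "\<lambda>\<gamma>. \<gamma> ** mat 1 ** matrix_inv \<gamma>"
    have "\<gamma> ** (mat 1 + unit_mat i j) ** matrix_inv \<gamma> = ?I \<gamma> + ?I \<gamma> - \<gamma> ** ?F ** matrix_inv \<gamma>"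
      for \<gamma> :: "int^'n^'n"
      by (simp add: matrix_add_ldistrib int_matrix_add_mult int_matrix_diff_mult int_matrix_mult_diff)
    then show "\<gamma> ** (mat 1 + unit_mat i j) ** matrix_inv \<gamma>
             = \<gamma>' ** (mat 1 + unit_mat i j) ** matrix_inv \<gamma>'"
      using com assms \<gamma>' by (simp add: matrix_inv_mult)
  qed (use assms \<gamma>' in auto)
  then show "Q' = conj_act \<gamma> (matrix_inv Q)" using \<gamma>' by simp
qed (use assms in auto)

lemma aut_act_sigma_aut:
  fixes Q :: "real^'n^'n"
  assumes "3 \<le> CARD('n)"
  shows "aut_act sigma_aut Q = matrix_inv Q"
proof -
  have inv: "matrix_inv (mat 1) = (mat 1 :: int^'n^'n)" "invertible (mat 1 :: int^'n^'n)"
    by (auto intro: matrix_inv_eqI simp: invertible_def)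
  have one: "map_matrix of_int (mat 1 :: int^'n^'n) = (mat 1 :: real^'n^'n)"
    by (simp add: vec_eq_iff mat_def)
  have closed: "matrix_inv (transpose X) \<in> carrier SL_int" if "X \<in> carrier SL_int" for X :: "int^'n^'n"
    using that by (simp add: SL_int_def SL_int_inv_closed)
  have "compose (carrier SL_int) (conj_aut (mat 1)) sigma_aut = (sigma_aut :: int^'n^'n \<Rightarrow> _)"
    by (auto simp: fun_eq_iff compose_def conj_aut_def sigma_aut_def inv closed)
  then show ?thesis
    using aut_act_conj_aut_sigma[of "mat 1" Q] assms inv one
    by (simp add: conj_act_def transpose_mat)
qed

end

theory Submission
  imports Defs
begin

text \<open>A model would contain a fixed point of every finite subgroup, so it suffices to find a finite
  subgroup of \<open>Aut(SL(n,\<int>))\<close> whose only fixed point in the space of lattices has systoles of rank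
  at most \<open>2\<close>. Let \<open>\<Lambda>\<close> be the orthogonal sum of \<open>\<int>\<^sup>d\<close>, where \<open>d \<in> {1, 2}\<close> has the parity of \<open>n\<close>,
  and of \<open>(n - d) / 2\<close> hexagonal lattices of covolume \<open>1\<close>. The hexagonal summands have minimum
  \<open>2 / \<surd>3 > 1\<close>, so the systoles of \<open>\<Lambda>\<close> span \<open>\<real>\<^sup>d\<close>. Each summand is isometric to its dual, so the
  stabilizer of \<open>\<Lambda>\<close>, a finite group, contains an element acting by a transform of \<open>Q \<mapsto> Q\<^sup>-\<^sup>1\<close>. The
  reflections of the summands force a fixed point to be an orthogonal sum of rescalings of them,
  and the duality fixes the scales.\<close>

section \<open>Automorphisms of the integral special linear group\<close>

text \<open>Left translation by an element of a finite closed set is injective, hence permutes the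
  set; solving equations there yields the identity and inverses. For a finite stabilizer it then
  suffices to check products.\<close>

lemma (in group) finite_closed_subgroup:
  assumes "H \<subseteq> carrier G" "finite H" "H \<noteq> {}"
    and closed: "\<And>a b. a \<in> H \<Longrightarrow> b \<in> H \<Longrightarrow> a \<otimes> b \<in> H"
  shows "subgroup H G"
proof -
  have surj: "(\<lambda>b. a \<otimes> b) ` H = H" if "a \<in> H" for a
  proof (rule endo_inj_surj)
    show "inj_on (\<lambda>b. a \<otimes> b) H"
      using that assms(1) by (intro inj_onI) (metis Units_eq Units_l_cancel subsetD)
  qed (use that assms in auto)
  have one: "\<one> \<in> H"
  proof -
    obtain a where a: "a \<in> H"
      using assms(3) by blast
    then obtain b where "b \<in> H" "a = a \<otimes> b"
      using surj[OF a] by (metis imageE)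
    moreover from this have "b = \<one>"
      using a assms(1) by (metis l_cancel_one' subsetD)
    ultimately show ?thesis by simp
  qed
  have "inv a \<in> H" if a: "a \<in> H" for a
  proof -
    obtain b where "b \<in> H" "a \<otimes> b = \<one>"
      using surj[OF a] one by (metis imageE)
    then show ?thesis
      using a assms(1) by (metis inv_equality inv_inv subsetD)
  qed
  then show ?thesis
    using assms one by (intro subgroupI) auto
qed

section \<open>Inverses of products and of transposes\<close>

lemma invertible_int_det:
  fixes \<gamma> :: "int^'n^'n"
  assumes "invertible \<gamma>"
  shows "det \<gamma> * det (matrix_inv \<gamma>) = 1"
  using matrix_inv_mult(1)[OF assms] by (metis det_I det_mul)

lemma matrix_inv_invertible:
  fixes A :: "'a::semiring_1^'n^'n"
  assumes "invertible A"
  shows "invertible (matrix_inv A)" "matrix_inv (matrix_inv A) = A"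
  using matrix_inv_mult[OF assms] by (auto simp: invertible_def intro: matrix_inv_eqI)

lemma matrix_inv_matrix_mult:
  fixes A B :: "'a::semiring_1^'n^'n"
  assumes "invertible A" "invertible B"
  shows "matrix_inv (A ** B) = matrix_inv B ** matrix_inv A"
proof (rule matrix_inv_eqI)
  note inv = matrix_inv_mult[OF assms(1)] matrix_inv_mult[OF assms(2)]
  have "A ** B ** (matrix_inv B ** matrix_inv A) = A ** (B ** matrix_inv B) ** matrix_inv A"
    by (simp only: matrix_mul_assoc)
  then show "A ** B ** (matrix_inv B ** matrix_inv A) = mat 1"
    by (simp add: inv)
  have "matrix_inv B ** matrix_inv A ** (A ** B) = matrix_inv B ** (matrix_inv A ** A) ** B"
    by (simp only: matrix_mul_assoc)
  then show "matrix_inv B ** matrix_inv A ** (A ** B) = mat 1"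
    by (simp add: inv)
qed

lemma matrix_inv_transpose:
  fixes A :: "'a::comm_semiring_1^'n^'n"
  assumes "invertible A"
  shows "invertible (transpose A)" "matrix_inv (transpose A) = transpose (matrix_inv A)"
proof -
  have "transpose A ** transpose (matrix_inv A) = mat 1" "transpose (matrix_inv A) ** transpose A = mat 1"
    using matrix_inv_mult[OF assms] by (metis matrix_transpose_mul transpose_mat)+
  then show "invertible (transpose A)" "matrix_inv (transpose A) = transpose (matrix_inv A)"
    by (auto simp: invertible_def intro: matrix_inv_eqI)
qed

section \<open>Conjugations, transpose-inverse and their relations\<close>

lemma conj_aut_closed:
  fixes \<gamma> X :: "int^'n^'n"
  assumes "invertible \<gamma>" "X \<in> carrier SL_int"
  shows "\<gamma> ** X ** matrix_inv \<gamma> \<in> carrier SL_int"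
  using assms invertible_int_det[OF assms(1)] by (simp add: SL_int_def det_mul)

lemma conj_aut_compose:
  fixes \<gamma> \<delta> :: "int^'n^'n"
  assumes "invertible \<gamma>" "invertible \<delta>"
  shows "compose (carrier SL_int) (conj_aut \<gamma>) (conj_aut \<delta>) = conj_aut (\<gamma> ** \<delta>)"
  using assms
  by (auto simp: fun_eq_iff compose_def conj_aut_def conj_aut_closed matrix_inv_matrix_mult
      matrix_mul_assoc)

lemma conj_aut_one: "conj_aut (mat 1) = (\<lambda>X\<in>carrier SL_int. X :: int^'n^'n)"
proof -
  have "matrix_inv (mat 1) = (mat 1 :: int^'n^'n)"
    by (rule matrix_inv_eqI) auto
  then show ?thesis
    by (simp add: conj_aut_def)
qed

lemma conj_aut_in_auto:
  fixes \<gamma> :: "int^'n^'n"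
  assumes "invertible \<gamma>"
  shows "conj_aut \<gamma> \<in> auto SL_int"
proof -
  note inv = matrix_inv_mult[OF assms] matrix_inv_invertible[OF assms]
  have comp: "conj_aut \<gamma> (conj_aut (matrix_inv \<gamma>) X) = X" "conj_aut (matrix_inv \<gamma>) (conj_aut \<gamma> X) = X"
    if "X \<in> carrier SL_int" for X
    using conj_aut_compose[of \<gamma> "matrix_inv \<gamma>", THEN fun_cong, of X]
      conj_aut_compose[of "matrix_inv \<gamma>" \<gamma>, THEN fun_cong, of X] that assms inv
    by (simp_all add: conj_aut_one compose_def)
  have closed: "conj_aut \<delta> X \<in> carrier SL_int" if "invertible \<delta>" "X \<in> carrier SL_int"
    for \<delta> X :: "int^'n^'n"
    using that by (simp add: conj_aut_def conj_aut_closed)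
  have "bij_betw (conj_aut \<gamma>) (carrier SL_int) (carrier SL_int)"
    by (rule bij_betwI[where g = "conj_aut (matrix_inv \<gamma>)"]) (use comp closed assms inv in auto)
  moreover have "conj_aut \<gamma> \<in> hom SL_int SL_int"
  proof (rule homI)
    fix X Y :: "int^'n^'n" assume XY: "X \<in> carrier SL_int" "Y \<in> carrier SL_int"
    have "\<gamma> ** X ** Y ** matrix_inv \<gamma> = \<gamma> ** X ** (matrix_inv \<gamma> ** \<gamma>) ** Y ** matrix_inv \<gamma>"
      by (simp add: inv)
    then show "conj_aut \<gamma> (X \<otimes>\<^bsub>SL_int\<^esub> Y) = conj_aut \<gamma> X \<otimes>\<^bsub>SL_int\<^esub> conj_aut \<gamma> Y"
      using XY by (simp add: conj_aut_def SL_int_def det_mul matrix_mul_assoc)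
  qed (use closed assms in auto)
  ultimately show ?thesis
    by (simp add: auto_def Bij_def conj_aut_def)
qed

lemma sigma_aut_closed:
  fixes X :: "int^'n^'n"
  assumes "X \<in> carrier SL_int"
  shows "matrix_inv (transpose X) \<in> carrier SL_int"
  using assms by (simp add: SL_int_def SL_int_inv_closed)

lemma sigma_aut_compose_self:
  "compose (carrier SL_int) sigma_aut sigma_aut = (\<lambda>X\<in>carrier SL_int. X :: int^'n^'n)"
proof -
  have "matrix_inv (transpose (matrix_inv (transpose X))) = X" if "X \<in> carrier SL_int" for X :: "int^'n^'n"
  proof -
    have X: "invertible X"
      using that by (simp add: SL_int_def SL_int_invertible)
    then show ?thesis
      by (simp add: matrix_inv_transpose matrix_inv_invertible)
  qed
  then show ?thesis
    by (auto simp: fun_eq_iff compose_def sigma_aut_def sigma_aut_closed)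
qed

lemma sigma_aut_in_auto: "(sigma_aut :: int^'n^'n \<Rightarrow> _) \<in> auto SL_int"
proof -
  have self: "sigma_aut (sigma_aut X) = X" if "X \<in> carrier SL_int" for X :: "int^'n^'n"
    using fun_cong[OF sigma_aut_compose_self, of X] that by (simp add: compose_def)
  have closed: "sigma_aut X \<in> carrier SL_int" if "X \<in> carrier SL_int" for X :: "int^'n^'n"
    using that by (simp add: sigma_aut_def sigma_aut_closed)
  have "bij_betw (sigma_aut :: int^'n^'n \<Rightarrow> _) (carrier SL_int) (carrier SL_int)"
    by (rule bij_betwI[where g = sigma_aut]) (use self closed in auto)
  moreover have "(sigma_aut :: int^'n^'n \<Rightarrow> _) \<in> hom SL_int SL_int"
  proof (rule homI)
    fix X Y :: "int^'n^'n" assume XY: "X \<in> carrier SL_int" "Y \<in> carrier SL_int"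
    then have "invertible X" "invertible Y"
      by (simp_all add: SL_int_def SL_int_invertible)
    then show "sigma_aut (X \<otimes>\<^bsub>SL_int\<^esub> Y) = sigma_aut X \<otimes>\<^bsub>SL_int\<^esub> sigma_aut Y"
      using XY by (simp add: sigma_aut_def SL_int_def det_mul matrix_transpose_mul
          matrix_inv_matrix_mult matrix_inv_transpose)
  qed (use closed in auto)
  ultimately show ?thesis
    by (simp add: auto_def Bij_def sigma_aut_def)
qed

text \<open>Transpose-inverse is multiplicative, so it turns conjugation by \<open>\<gamma>\<close>
  into conjugation by the contragredient of \<open>\<gamma>\<close>. This rule moves
  \<open>sigma_aut\<close> to the right in products.\<close>

lemma sigma_aut_conj_aut:
  fixes \<gamma> :: "int^'n^'n"
  assumes "invertible \<gamma>"
  shows "compose (carrier SL_int) sigma_aut (conj_aut \<gamma>)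
       = compose (carrier SL_int) (conj_aut (transpose (matrix_inv \<gamma>))) sigma_aut"
proof -
  note inv = assms matrix_inv_invertible[OF assms]
  have "matrix_inv (transpose (\<gamma> ** X ** matrix_inv \<gamma>))
      = transpose (matrix_inv \<gamma>) ** matrix_inv (transpose X) ** matrix_inv (transpose (matrix_inv \<gamma>))"
    if "X \<in> carrier SL_int" for X
  proof -
    have "invertible X"
      using that by (simp add: SL_int_def SL_int_invertible)
    with inv show ?thesis
      by (simp add: matrix_transpose_mul matrix_inv_matrix_mult matrix_inv_transpose invertible_mult
          matrix_mul_assoc)
  qed
  with assms show ?thesis
    by (auto simp: fun_eq_iff compose_def conj_aut_def sigma_aut_def sigma_aut_closed conj_aut_closed)
qed

section \<open>Finite groups of automorphisms from isometries and similarities with the dual\<close>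

text \<open>The integral equivalences from the form \<open>P\<close> to the form \<open>P'\<close>;
  \<open>form_maps P P\<close> is the integral orthogonal group of \<open>P\<close>.\<close>

definition form_maps :: "real^'n^'n \<Rightarrow> real^'n^'n \<Rightarrow> (int^'n^'n) set" where
  "form_maps P P' = {\<gamma>. invertible \<gamma> \<and>
     transpose (map_matrix of_int \<gamma>) ** P ** map_matrix of_int \<gamma> = P'}"

text \<open>The automorphisms of the two kinds that fix the point \<open>P\<close>, expressed
  through \<open>\<gamma>\<close> rather than its inverse: \<open>conj_act \<gamma> P = P\<close>
  says that \<open>\<gamma>\<close> preserves \<open>P\<close>, and
  \<open>conj_act \<gamma> (matrix_inv P) = P\<close> says that \<open>\<gamma>\<close> carries
  \<open>P\<close> to \<open>matrix_inv P\<close>.\<close>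

definition form_stabilizer :: "real^'n^'n \<Rightarrow> (int^'n^'n \<Rightarrow> int^'n^'n) set" where
  "form_stabilizer P = conj_aut ` form_maps P P \<union>
     (\<lambda>\<gamma>. compose (carrier SL_int) (conj_aut \<gamma>) sigma_aut) ` form_maps P (matrix_inv P)"

lemma form_maps_mult:
  assumes "\<gamma> \<in> form_maps P P'" "\<delta> \<in> form_maps P' P''"
  shows "\<gamma> ** \<delta> \<in> form_maps P P''"
proof -
  let ?R = "map_matrix real_of_int"
  have "transpose (?R (\<gamma> ** \<delta>)) ** P ** ?R (\<gamma> ** \<delta>)
      = transpose (?R \<delta>) ** (transpose (?R \<gamma>) ** P ** ?R \<gamma>) ** ?R \<delta>"
    by (simp add: map_of_int_mult matrix_transpose_mul matrix_mul_assoc)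
  with assms show ?thesis
    by (simp add: form_maps_def invertible_mult)
qed

lemma map_of_int_inverse:
  fixes \<gamma> :: "int^'n^'n"
  assumes "invertible \<gamma>"
  shows "invertible (map_matrix real_of_int \<gamma>)"
    "map_matrix real_of_int (matrix_inv \<gamma>) = matrix_inv (map_matrix real_of_int \<gamma>)"
proof -
  have "map_matrix real_of_int \<gamma> ** map_matrix real_of_int (matrix_inv \<gamma>) = mat 1"
    "map_matrix real_of_int (matrix_inv \<gamma>) ** map_matrix real_of_int \<gamma> = mat 1"
    using matrix_inv_mult[OF assms] by (metis map_of_int_mult map_of_int_mat_1)+
  then show "invertible (map_matrix real_of_int \<gamma>)"
    "map_matrix real_of_int (matrix_inv \<gamma>) = matrix_inv (map_matrix real_of_int \<gamma>)"
    by (auto simp: invertible_def intro: matrix_inv_eqI[symmetric])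
qed

lemma map_of_int_transpose:
  "map_matrix real_of_int (transpose \<gamma>) = transpose (map_matrix real_of_int \<gamma>)" for \<gamma> :: "int^'n^'n"
  by (simp add: vec_eq_iff transpose_def)

text \<open>Inverting both sides of the congruence turns it into one between the inverse forms, by
  the contragredient matrix.\<close>

lemma form_maps_dual:
  assumes "\<gamma> \<in> form_maps P P'" "invertible P"
  shows "transpose (matrix_inv \<gamma>) \<in> form_maps (matrix_inv P) (matrix_inv P')"
proof -
  let ?R = "map_matrix real_of_int"
  have \<gamma>: "invertible \<gamma>" and eq: "transpose (?R \<gamma>) ** P ** ?R \<gamma> = P'"
    using assms by (auto simp: form_maps_def)
  note inv = map_of_int_inverse[OF \<gamma>]
  have "matrix_inv P' = matrix_inv (?R \<gamma>) ** matrix_inv P ** transpose (matrix_inv (?R \<gamma>))"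
    using inv assms(2) unfolding eq[symmetric]
    by (simp add: matrix_inv_matrix_mult matrix_inv_transpose invertible_mult matrix_mul_assoc)
  then show ?thesis
    using \<gamma> inv by (simp add: form_maps_def matrix_inv_transpose matrix_inv_invertible
        map_of_int_transpose)
qed

text \<open>The elements compose like integral equivalences among \<open>P\<close> and its inverse:
  moving \<open>sigma_aut\<close> past a conjugation replaces the matrix by its contragredient,
  which acts between the inverse forms. Being finite, the set is a subgroup once it is closed under
  products.\<close>

lemma form_stabilizer_subgroup:
  fixes P :: "real^'n^'n"
  assumes P: "invertible P" and fin: "\<And>P'. finite (form_maps P P')"
  shows "subgroup (form_stabilizer P) (AutoGroup SL_int)" "finite (form_stabilizer P)"
proof -
  interpret G: group "AutoGroup (SL_int :: (int^'n^'n) monoid)"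
    by (rule group.AutoGroup[OF group_SL_int])
  let ?C = "carrier (SL_int :: (int^'n^'n) monoid)" and ?G = "AutoGroup (SL_int :: (int^'n^'n) monoid)"
  have carrier: "carrier ?G = auto SL_int"
    by (simp add: AutoGroup_def)
  have Bij: "f \<in> Bij ?C" if "f \<in> auto SL_int" for f
    using that by (simp add: auto_def)
  have mult: "f \<otimes>\<^bsub>?G\<^esub> g = compose ?C f g" if "f \<in> auto SL_int" "g \<in> auto SL_int" for f g
    using that by (simp add: AutoGroup_def BijGroup_def Bij)
  let ?s = "sigma_aut :: int^'n^'n \<Rightarrow> int^'n^'n"
  have one: "\<one>\<^bsub>?G\<^esub> = (\<lambda>X\<in>?C. X)"
    by (simp add: AutoGroup_def BijGroup_def)
  have s: "?s \<in> carrier ?G" "?s \<otimes>\<^bsub>?G\<^esub> ?s = \<one>\<^bsub>?G\<^esub>"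
    by (simp_all add: sigma_aut_in_auto carrier mult one sigma_aut_compose_self)
  have c: "conj_aut \<gamma> \<in> carrier ?G" if "invertible \<gamma>" for \<gamma> :: "int^'n^'n"
    using that by (simp add: carrier conj_aut_in_auto)
  have conj_mult: "conj_aut \<gamma> \<otimes>\<^bsub>?G\<^esub> conj_aut \<delta> = conj_aut (\<gamma> ** \<delta>)"
    if "invertible \<gamma>" "invertible \<delta>" for \<gamma> \<delta> :: "int^'n^'n"
    using that by (simp add: mult conj_aut_in_auto conj_aut_compose)
  have cs: "compose ?C (conj_aut \<gamma>) ?s = conj_aut \<gamma> \<otimes>\<^bsub>?G\<^esub> ?s"
    if "invertible \<gamma>" for \<gamma> :: "int^'n^'n"
    using that by (simp add: mult conj_aut_in_auto sigma_aut_in_auto)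
  have sc: "?s \<otimes>\<^bsub>?G\<^esub> conj_aut \<gamma> = conj_aut (transpose (matrix_inv \<gamma>)) \<otimes>\<^bsub>?G\<^esub> ?s"
    if "invertible \<gamma>" for \<gamma> :: "int^'n^'n"
    using that by (simp add: mult conj_aut_in_auto sigma_aut_in_auto sigma_aut_conj_aut
        matrix_inv_invertible matrix_inv_transpose)
  let ?t = "\<lambda>\<gamma> :: int^'n^'n. transpose (matrix_inv \<gamma>)"
  have t: "invertible (?t \<gamma>)" if "invertible \<gamma>" for \<gamma>
    using that by (simp add: matrix_inv_invertible matrix_inv_transpose)
  have csc: "(conj_aut \<gamma> \<otimes>\<^bsub>?G\<^esub> ?s) \<otimes>\<^bsub>?G\<^esub> conj_aut \<delta> = conj_aut (\<gamma> ** ?t \<delta>) \<otimes>\<^bsub>?G\<^esub> ?s"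
    if "invertible \<gamma>" "invertible \<delta>" for \<gamma> \<delta> :: "int^'n^'n"
  proof -
    have "(conj_aut \<gamma> \<otimes>\<^bsub>?G\<^esub> ?s) \<otimes>\<^bsub>?G\<^esub> conj_aut \<delta>
        = conj_aut \<gamma> \<otimes>\<^bsub>?G\<^esub> (conj_aut (?t \<delta>) \<otimes>\<^bsub>?G\<^esub> ?s)"
      using that by (simp add: G.m_assoc s c sc)
    also have "\<dots> = conj_aut (\<gamma> ** ?t \<delta>) \<otimes>\<^bsub>?G\<^esub> ?s"
      using that by (simp add: s c t conj_mult flip: G.m_assoc)
    finally show ?thesis .
  qed
  have cscs: "(conj_aut \<gamma> \<otimes>\<^bsub>?G\<^esub> ?s) \<otimes>\<^bsub>?G\<^esub> (conj_aut \<delta> \<otimes>\<^bsub>?G\<^esub> ?s) = conj_aut (\<gamma> ** ?t \<delta>)"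
    if "invertible \<gamma>" "invertible \<delta>" for \<gamma> \<delta> :: "int^'n^'n"
  proof -
    have "(conj_aut \<gamma> \<otimes>\<^bsub>?G\<^esub> ?s) \<otimes>\<^bsub>?G\<^esub> (conj_aut \<delta> \<otimes>\<^bsub>?G\<^esub> ?s)
        = ((conj_aut \<gamma> \<otimes>\<^bsub>?G\<^esub> ?s) \<otimes>\<^bsub>?G\<^esub> conj_aut \<delta>) \<otimes>\<^bsub>?G\<^esub> ?s"
      using that by (simp add: G.m_assoc s c)
    also have "\<dots> = conj_aut (\<gamma> ** ?t \<delta>) \<otimes>\<^bsub>?G\<^esub> (?s \<otimes>\<^bsub>?G\<^esub> ?s)"
      unfolding csc[OF that] using that by (simp add: invertible_mult t G.m_assoc s(1) c)
    finally show ?thesis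
      using that by (simp add: s c t invertible_mult)
  qed
  have inv: "invertible \<gamma>" if "\<gamma> \<in> form_maps P P'" for \<gamma> P'
    using that by (simp add: form_maps_def)
  have dual: "?t \<gamma> \<in> form_maps (matrix_inv P) (matrix_inv P')" if "\<gamma> \<in> form_maps P P'" for \<gamma> P'
    using form_maps_dual[OF that P] .
  have dual': "?t \<gamma> \<in> form_maps (matrix_inv P) P" if "\<gamma> \<in> form_maps P (matrix_inv P)" for \<gamma>
    using dual[OF that] P by (simp add: matrix_inv_invertible)
  have H: "form_stabilizer P = conj_aut ` form_maps P P \<union>
     (\<lambda>\<gamma>. conj_aut \<gamma> \<otimes>\<^bsub>?G\<^esub> ?s) ` form_maps P (matrix_inv P)"
    unfolding form_stabilizer_def using cs inv by (auto simp: image_iff)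
  show finite: "finite (form_stabilizer P)"
    by (simp add: form_stabilizer_def fin)
  have "mat 1 \<in> form_maps P P"
    by (simp add: form_maps_def map_of_int_mat_1 invertible_def exI[of _ "mat 1"])
  then have "form_stabilizer P \<noteq> {}"
    by (auto simp: form_stabilizer_def)
  moreover have "form_stabilizer P \<subseteq> carrier ?G"
    unfolding H using c s inv by auto
  moreover have "a \<otimes>\<^bsub>?G\<^esub> b \<in> form_stabilizer P"
    if ab: "a \<in> form_stabilizer P" "b \<in> form_stabilizer P" for a b
  proof -
    \<comment> \<open>Four cases, according to which of the factors involve
      \<open>sigma_aut\<close>; two occurrences cancel.\<close>
    consider (cc) \<gamma> \<delta> where "a = conj_aut \<gamma>" "b = conj_aut \<delta>"
        "\<gamma> \<in> form_maps P P" "\<delta> \<in> form_maps P P"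
      | (cd) \<gamma> \<delta> where "a = conj_aut \<gamma>" "b = conj_aut \<delta> \<otimes>\<^bsub>?G\<^esub> ?s"
        "\<gamma> \<in> form_maps P P" "\<delta> \<in> form_maps P (matrix_inv P)"
      | (dc) \<gamma> \<delta> where "a = conj_aut \<gamma> \<otimes>\<^bsub>?G\<^esub> ?s" "b = conj_aut \<delta>"
        "\<gamma> \<in> form_maps P (matrix_inv P)" "\<delta> \<in> form_maps P P"
      | (dd) \<gamma> \<delta> where "a = conj_aut \<gamma> \<otimes>\<^bsub>?G\<^esub> ?s" "b = conj_aut \<delta> \<otimes>\<^bsub>?G\<^esub> ?s"
        "\<gamma> \<in> form_maps P (matrix_inv P)" "\<delta> \<in> form_maps P (matrix_inv P)"
      using ab unfolding H by blast
    then show ?thesis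
    proof cases
      case cc
      then have "a \<otimes>\<^bsub>?G\<^esub> b = conj_aut (\<gamma> ** \<delta>)"
        using inv by (simp add: conj_mult)
      then show ?thesis
        using form_maps_mult[OF cc(3,4)] unfolding H by blast
    next
      case cd
      then have "a \<otimes>\<^bsub>?G\<^esub> b = conj_aut (\<gamma> ** \<delta>) \<otimes>\<^bsub>?G\<^esub> ?s"
        using inv by (simp add: c s conj_mult flip: G.m_assoc)
      then show ?thesis
        using form_maps_mult[OF cd(3,4)] unfolding H by blast
    next
      case dc
      then have "a \<otimes>\<^bsub>?G\<^esub> b = conj_aut (\<gamma> ** ?t \<delta>) \<otimes>\<^bsub>?G\<^esub> ?s"
        using inv by (simp add: csc)
      then show ?thesis
        using form_maps_mult[OF dc(3) dual[OF dc(4)]] unfolding H by blast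
    next
      case dd
      then have "a \<otimes>\<^bsub>?G\<^esub> b = conj_aut (\<gamma> ** ?t \<delta>)"
        using inv by (simp add: cscs)
      then show ?thesis
        using form_maps_mult[OF dd(3) dual'[OF dd(4)]] unfolding H by blast
    qed
  qed
  ultimately show "subgroup (form_stabilizer P) ?G"
    using finite by (intro G.finite_closed_subgroup)
qed


section \<open>Finiteness of the set of integral equivalences\<close>

lemma matrix_congruence_diagonal:
  fixes A P :: "real^'n^'n"
  shows "(transpose A ** P ** A) $ j $ j = column j A \<bullet> (P *v column j A)"
proof -
  have "(transpose A ** P ** A) $ j $ j = (\<Sum>k\<in>UNIV. \<Sum>l\<in>UNIV. A $ l $ j * P $ l $ k * A $ k $ j)"
    by (simp add: matrix_matrix_mult_def transpose_def sum_distrib_right)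
  also have "\<dots> = (\<Sum>l\<in>UNIV. \<Sum>k\<in>UNIV. A $ l $ j * P $ l $ k * A $ k $ j)"
    by (rule sum.swap)
  also have "\<dots> = column j A \<bullet> (P *v column j A)"
    by (simp add: inner_vec_def matrix_vector_mult_def column_def sum_distrib_left mult.assoc)
  finally show ?thesis .
qed

lemma finite_int_matrices_bounded: "finite {\<gamma> :: int^'n^'n. \<forall>i j. \<bar>\<gamma> $ i $ j\<bar> \<le> N}"
proof (rule finite_subset)
  show "{\<gamma> :: int^'n^'n. \<forall>i j. \<bar>\<gamma> $ i $ j\<bar> \<le> N}
      \<subseteq> (\<lambda>g. \<chi> i j. g (i, j)) ` (PiE UNIV (\<lambda>_. {-N..N}))"
  proof
    fix \<gamma> :: "int^'n^'n" assume \<gamma>: "\<gamma> \<in> {\<gamma>. \<forall>i j. \<bar>\<gamma> $ i $ j\<bar> \<le> N}"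
    have "-N \<le> \<gamma> $ i $ j \<and> \<gamma> $ i $ j \<le> N" for i j
      using \<gamma> by (simp add: abs_le_iff) (metis minus_le_iff)
    then show "\<gamma> \<in> (\<lambda>g. \<chi> i j. g (i, j)) ` (PiE UNIV (\<lambda>_. {-N..N}))"
      by (intro image_eqI[of _ _ "\<lambda>(i, j). \<gamma> $ i $ j"]) (auto simp: vec_eq_iff)
  qed
qed (intro finite_imageI finite_PiE; simp)

text \<open>On column \<open>j\<close> of an equivalence, \<open>P\<close> takes the value
  \<open>P' $ j $ j\<close>. The lower bound on \<open>P\<close> then bounds all entries, which
  leaves finitely many integer matrices.\<close>

lemma finite_form_maps:
  fixes P P' :: "real^'n^'n"
  assumes "\<delta> > 0" and pos: "\<And>v i. \<delta> * (v $ i)\<^sup>2 \<le> v \<bullet> (P *v v)"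
  shows "finite (form_maps P P')"
proof (rule finite_subset[OF _ finite_int_matrices_bounded])
  \<comment> \<open>Summing over the whole diagonal gives one bound that serves every
    column.\<close>
  define B where "B = (\<Sum>j\<in>UNIV. \<bar>P' $ j $ j\<bar>) / \<delta>"
  show "form_maps P P' \<subseteq> {\<gamma>. \<forall>i j. \<bar>\<gamma> $ i $ j\<bar> \<le> \<lceil>B\<rceil>}"
  proof safe
    fix \<gamma> i j assume "\<gamma> \<in> form_maps P P'"
    then have eq: "transpose (map_matrix of_int \<gamma>) ** P ** map_matrix of_int \<gamma> = P'"
      by (simp add: form_maps_def)
    have "\<delta> * (of_int (\<gamma> $ i $ j))\<^sup>2 \<le> P' $ j $ j"
      using pos[of "column j (map_matrix of_int \<gamma>)" i]
      unfolding eq[symmetric] matrix_congruence_diagonal by (simp add: column_def)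
    also have "\<dots> \<le> (\<Sum>j\<in>UNIV. \<bar>P' $ j $ j\<bar>)"
      by (rule order_trans[OF abs_ge_self member_le_sum[of j UNIV "\<lambda>j. \<bar>P' $ j $ j\<bar>"]]) auto
    finally have "(of_int (\<gamma> $ i $ j))\<^sup>2 \<le> B"
      using \<open>\<delta> > 0\<close> by (simp add: B_def field_simps)
    then have "(\<gamma> $ i $ j)\<^sup>2 \<le> \<lceil>B\<rceil>"
      by (metis ceiling_mono ceiling_of_int of_int_power)
    \<comment> \<open>The absolute value of an integer is at most its square, so the bound on the
      square also bounds the entry.\<close>
    moreover have "\<bar>\<gamma> $ i $ j\<bar> \<le> \<bar>\<gamma> $ i $ j\<bar> * \<bar>\<gamma> $ i $ j\<bar>"
      using mult_right_mono[of 1 "\<bar>\<gamma> $ i $ j\<bar>" "\<bar>\<gamma> $ i $ j\<bar>"] by (cases "\<gamma> $ i $ j = 0") auto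
    ultimately show "\<bar>\<gamma> $ i $ j\<bar> \<le> \<lceil>B\<rceil>"
      by (simp add: power2_eq_square abs_mult_self_eq)
  qed
qed

section \<open>Reflections and diagonal matrices\<close>

text \<open>The matrix of \<open>v \<mapsto> v - f(v) e_j\<close>, with \<open>f\<close> read as a
  linear form and \<open>e_j\<close> a basis vector. For \<open>f j = 2\<close> it negates
  \<open>e_j\<close> and fixes the kernel of \<open>f\<close>.\<close>

definition reflection_mat :: "('n \<Rightarrow> 'a::comm_ring_1) \<Rightarrow> 'n \<Rightarrow> 'a^'n^'n" where
  "reflection_mat f j = (\<chi> a b. (if a = b then 1 else 0) - (if a = j then f b else 0))"

definition diag_mat :: "('n \<Rightarrow> 'a::comm_ring_1) \<Rightarrow> 'a^'n^'n" where
  "diag_mat e = (\<chi> a b. if a = b then e a else 0)"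

lemma mult_reflection_mat: "(M ** reflection_mat f j) $ a $ b = M $ a $ b - M $ a $ j * f b"
  by (simp add: matrix_matrix_mult_def reflection_mat_def right_diff_distrib sum_subtractf
      if_distrib[where f="\<lambda>x. _ * x"] cong: if_cong)

lemma transpose_reflection_mat_mult:
  "(transpose (reflection_mat f j) ** M) $ a $ b = M $ a $ b - f a * M $ j $ b"
  by (simp add: matrix_matrix_mult_def transpose_def reflection_mat_def left_diff_distrib
      sum_subtractf if_distrib[where f="\<lambda>x. x * _"] cong: if_cong)

lemma reflection_mat_square:
  assumes "f j = 2"
  shows "reflection_mat f j ** reflection_mat f j = mat 1"
  using assms by (auto simp: vec_eq_iff mult_reflection_mat)
    (auto simp: reflection_mat_def mat_def algebra_simps)

lemma map_of_int_reflection_mat: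
  "map_matrix real_of_int (reflection_mat f j) = reflection_mat (\<lambda>b. of_int (f b)) j"
  by (simp add: vec_eq_iff reflection_mat_def)

lemma mult_diag_mat: "(M ** diag_mat e) $ a $ b = M $ a $ b * e b"
  by (simp add: matrix_matrix_mult_def diag_mat_def if_distrib[where f="\<lambda>x. _ * x"] cong: if_cong)

lemma transpose_diag_mat: "transpose (diag_mat e) = diag_mat e"
  by (auto simp: vec_eq_iff diag_mat_def transpose_def)

lemma map_of_int_diag_mat:
  "map_matrix real_of_int (diag_mat e) = diag_mat (\<lambda>b. of_int (e b))"
  by (simp add: vec_eq_iff diag_mat_def)

lemma diag_mat_square:
  assumes "\<And>a. e a * e a = 1"
  shows "diag_mat e ** diag_mat e = mat 1"
  using assms by (auto simp: vec_eq_iff mult_diag_mat) (auto simp: diag_mat_def mat_def)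

text \<open>The reflection preserves \<open>Q\<close> exactly when the basis vector that it negates
  is \<open>Q\<close>-orthogonal to the kernel of \<open>f\<close>, that is, when row
  \<open>j\<close> of \<open>Q\<close> is a multiple of \<open>f\<close>; the entry at
  \<open>j\<close> determines the factor.\<close>

lemma reflection_mat_invariant_iff:
  fixes Q :: "real^'n^'n"
  assumes "f j = 2" and sym: "\<And>a b. Q $ a $ b = Q $ b $ a"
  shows "transpose (reflection_mat f j) ** Q ** reflection_mat f j = Q
    \<longleftrightarrow> (\<forall>b. Q $ j $ b = Q $ j $ j / 2 * f b)"
proof -
  have entry: "(transpose (reflection_mat f j) ** Q ** reflection_mat f j) $ a $ b
      = Q $ a $ b - f a * Q $ j $ b - (Q $ a $ j - f a * Q $ j $ j) * f b" for a b
    by (simp add: mult_reflection_mat transpose_reflection_mat_mult)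
  show ?thesis
  proof
    assume inv: "transpose (reflection_mat f j) ** Q ** reflection_mat f j = Q"
    show "\<forall>b. Q $ j $ b = Q $ j $ j / 2 * f b"
    proof
      fix b
      show "Q $ j $ b = Q $ j $ j / 2 * f b"
        using entry[of j b] unfolding inv by (simp add: assms(1) algebra_simps)
    qed
  next
    assume row: "\<forall>b. Q $ j $ b = Q $ j $ j / 2 * f b"
    then have "Q $ a $ j = Q $ j $ j / 2 * f a" for a
      using sym by metis
    then have "f a * Q $ j $ b + (Q $ a $ j - f a * Q $ j $ j) * f b = 0" for a b
      unfolding row[rule_format, of b] by (simp add: algebra_simps)
    then show "transpose (reflection_mat f j) ** Q ** reflection_mat f j = Q"
      by (simp add: vec_eq_iff entry algebra_simps)
  qed
qed

section \<open>The lattice\<close>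

text \<open>Number the indices from 0 and pair each even number with its successor, leaving the last
  one or two numbers alone; the sign records the parity.\<close>

lemma exists_pairing:
  "\<exists>(r :: 'n::finite \<Rightarrow> 'n) (e :: 'n \<Rightarrow> int).
     (\<forall>i. r (r i) = i) \<and> (\<forall>i. e i * e i = 1) \<and> (\<forall>i. r i \<noteq> i \<longrightarrow> e (r i) = - e i) \<and>
     {i. r i = i} \<noteq> {} \<and> card {i. r i = i} \<le> 2"
proof -
  \<comment> \<open>The number of pairs. Subtracting 1 before halving leaves one index over for odd
    dimension and two for even dimension, never none.\<close>
  define m where "m = (CARD('n) - 1) div 2"
  obtain f :: "'n \<Rightarrow> nat" where f: "bij_betw f UNIV {..<CARD('n)}"
    using ex_bij_betw_finite_nat[of "UNIV :: 'n set"] by (auto simp: atLeast0LessThan)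
  define g where "g = inv_into UNIV f"
  have fg: "f (g k) = k" if "k < CARD('n)" for k
    using that f by (simp add: g_def bij_betw_inv_into_right)
  have gf: "g (f i) = i" for i
    using f by (simp add: g_def bij_betw_inv_into_left)
  have lt: "f i < CARD('n)" for i
    using f by (auto simp: bij_betw_def)
  have "CARD('n) > 0" by simp
  then have m: "2 * m < CARD('n)" "CARD('n) \<le> 2 * m + 2"
    unfolding m_def by linarith+
  define p :: "nat \<Rightarrow> nat" where "p k = (if k < 2 * m then if even k then k + 1 else k - 1 else k)" for k
  have p: "p k < CARD('n) \<and> p (p k) = k \<and> (p k = k \<longleftrightarrow> 2 * m \<le> k) \<and> (p k \<noteq> k \<longrightarrow> even (p k) \<noteq> even k)"
    if "k < CARD('n)" for k
  proof -
    consider "2 * m \<le> k" | j where "k = 2 * j" "j < m" | j where "k = 2 * j + 1" "j < m"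
    proof (cases "k < 2 * m")
      case True
      then have "k div 2 < m" by linarith
      moreover have "k = 2 * (k div 2) \<or> k = 2 * (k div 2) + 1" by linarith
      ultimately show ?thesis using that by blast
    qed (use that in auto)
    then show ?thesis
      using that m by cases (simp_all add: p_def)
  qed
  define r where "r i = g (p (f i))" for i
  define e :: "'n \<Rightarrow> int" where "e i = (if even (f i) then 1 else -1)" for i
  have fr: "f (r i) = p (f i)" for i
    by (simp add: r_def fg p lt)
  have fix_iff: "r i = i \<longleftrightarrow> 2 * m \<le> f i" for i
    using p[OF lt[of i]] fr[of i] gf[of i] by (metis r_def)
  have "r (r i) = i" for i
    using p[OF lt[of i]] fr[of i] gf[of i] by (simp add: r_def)
  moreover have "e i * e i = 1" for i
    by (simp add: e_def)
  moreover have "e (r i) = - e i" if "r i \<noteq> i" for i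
    using p[OF lt[of i]] that fix_iff[of i] by (auto simp: e_def fr)
  moreover have "g (2 * m) \<in> {i. r i = i}"
    by (simp add: fix_iff fg m)
  moreover have "card {i. r i = i} \<le> 2"
  proof -
    have "f ` {i. r i = i} \<subseteq> {2 * m..<2 * m + 2}"
      using less_le_trans[OF lt m(2)] by (auto simp: fix_iff)
    then have "card (f ` {i. r i = i}) \<le> 2"
      using card_mono[of "{2 * m..<2 * m + 2}"] by fastforce
    moreover have "inj_on f {i. r i = i}"
      using f by (auto simp: bij_betw_def intro: inj_on_subset)
    ultimately show ?thesis
      by (simp add: card_image)
  qed
  ultimately show ?thesis
    by blast
qed

text \<open>The map \<open>r\<close> exchanges the two basis vectors of each hexagonal summand, and its fixed points
  are the basis vectors of \<open>\<int>\<^sup>d\<close>. The signs \<open>e\<close> form the diagonal of an isometry of \<open>\<Lambda>\<close> with its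
  dual: on a hexagonal summand, \<open>diag(1, -1)\<close> turns the matrix \<open>(2 1; 1 2)\<close> into three times its
  inverse.\<close>

locale pairing =
  fixes r :: "'n::finite \<Rightarrow> 'n" and e :: "'n \<Rightarrow> int"
  assumes r_r [simp]: "r (r i) = i"
    and e_square: "e i * e i = 1"
    and e_r: "r i \<noteq> i \<Longrightarrow> e (r i) = - e i"
    and fixed_nonempty: "{i. r i = i} \<noteq> {}"
    and card_fixed: "card {i. r i = i} \<le> 2"
begin

text \<open>Block diagonal with blocks \<open>(2)\<close> and \<open>(2 1; 1 2)\<close>: up to the
  sign of one basis vector in each pair, the Cartan matrix of a sum of root systems
  \<open>A1\<close> and \<open>A2\<close>. Row \<open>a\<close> is the linear form of the reflection
  in basis vector \<open>a\<close>.\<close>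

definition cartan :: "'n \<Rightarrow> 'n \<Rightarrow> int" where
  "cartan a b = (if b = a then 2 else if b = r a then 1 else 0)"

definition block_form :: "('n \<Rightarrow> real) \<Rightarrow> real^'n^'n" where
  "block_form y = (\<chi> a b. y a * of_int (cartan a b))"

text \<open>The blocks \<open>(2)\<close> and \<open>(2 1; 1 2)\<close> have determinants 2 and 3;
  these factors make each block of determinant 1.\<close>

definition scale :: "'n \<Rightarrow> real" where
  "scale a = (if r a = a then 1 / 2 else 1 / sqrt 3)"

section \<open>Block forms, their duality and uniqueness\<close>

lemma sum_cartan:
  "(\<Sum>k\<in>UNIV. of_int (cartan a k) * g k) = (if r a = a then 2 * g a else 2 * g a + g (r a))"
  for g :: "'n \<Rightarrow> real"
proof -
  have "(\<Sum>k\<in>UNIV. of_int (cartan a k) * g k) = (\<Sum>k\<in>{a, r a}. of_int (cartan a k) * g k)"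
    by (rule sum.mono_neutral_right) (auto simp: cartan_def)
  then show ?thesis
    by (auto simp: cartan_def)
qed

lemma block_form_sym:
  assumes "\<And>a. y (r a) = y a"
  shows "block_form y $ a $ b = block_form y $ b $ a"
  using assms by (auto simp: block_form_def cartan_def)

lemma scale_r: "scale (r a) = scale a"
  by (auto simp: scale_def)

lemma scale_pos: "scale a > 0"
  by (simp add: scale_def)

text \<open>On a pair, \<open>C = (2 1; 1 2)\<close> and \<open>D = diag(1, -1)\<close> satisfy
  \<open>C D C = 3 D\<close>: the off-diagonal terms cancel because the signs are opposite. On a
  fixed index the factor is \<open>2 * 2 = 4\<close>.\<close>

lemma block_form_diag:
  assumes "\<And>a. y (r a) = y a"
  shows "block_form y ** diag_mat (\<lambda>a. of_int (e a)) ** block_form y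
       = diag_mat (\<lambda>a. (if r a = a then 4 else 3) * (y a)\<^sup>2 * of_int (e a))"
proof -
  have "(block_form y ** diag_mat (\<lambda>a. of_int (e a)) ** block_form y) $ a $ b
      = y a * (\<Sum>k\<in>UNIV. of_int (cartan a k) * (of_int (e k) * y k * of_int (cartan k b)))" for a b
    by (subst matrix_matrix_mult_def)
      (simp add: mult_diag_mat block_form_def sum_distrib_left mult_ac)
  moreover have "y a * (\<Sum>k\<in>UNIV. of_int (cartan a k) * (of_int (e k) * y k * of_int (cartan k b)))
      = (if a = b then (if r a = a then 4 else 3) * (y a)\<^sup>2 * of_int (e a) else 0)" for a b
    using e_r[of a] unfolding sum_cartan
    by (auto simp: assms cartan_def power2_eq_square algebra_simps)
  ultimately show ?thesis
    by (simp add: vec_eq_iff diag_mat_def)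
qed

lemma block_form_scale_diag:
  "block_form scale ** diag_mat (\<lambda>a. of_int (e a)) ** block_form scale = diag_mat (\<lambda>a. of_int (e a))"
proof -
  have "(if r a = a then 4 else 3) * (scale a)\<^sup>2 = 1" for a
    by (simp add: scale_def power_divide)
  then show ?thesis
    by (simp add: block_form_diag scale_r)
qed

lemma diag_e_square:
  "diag_mat e ** diag_mat e = mat 1"
  "diag_mat (\<lambda>a. real_of_int (e a)) ** diag_mat (\<lambda>a. of_int (e a)) = mat 1"
  using e_square by (auto intro!: diag_mat_square simp flip: of_int_mult)

text \<open>With \<open>B\<close> the form and \<open>D\<close> the sign matrix,
  \<open>B D B = D\<close> and \<open>D D = 1\<close> give \<open>B (D B D) = 1\<close>. Thus
  \<open>D\<close> is an integral equivalence of the form with its inverse.\<close>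

lemma matrix_inv_block_form_scale:
  "invertible (block_form scale)"
  "matrix_inv (block_form scale)
     = diag_mat (\<lambda>a. of_int (e a)) ** block_form scale ** diag_mat (\<lambda>a. of_int (e a))"
proof -
  let ?D = "diag_mat (\<lambda>a. real_of_int (e a))"
  have "block_form scale ** (?D ** block_form scale ** ?D) = mat 1"
    by (simp add: matrix_mul_assoc block_form_scale_diag diag_e_square)
  moreover from this have "(?D ** block_form scale ** ?D) ** block_form scale = mat 1"
    by (simp add: matrix_left_right_inverse)
  ultimately show "invertible (block_form scale)" "matrix_inv (block_form scale) = ?D ** block_form scale ** ?D"
    by (auto simp: invertible_def intro: matrix_inv_eqI)
qed

text \<open>Invariance under the reflections makes each row of \<open>Q\<close> a multiple
  \<open>y a\<close> of the row of \<open>cartan\<close>. The duality then fixes the square of each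
  factor, and nonnegativity its sign.\<close>

lemma block_form_unique:
  fixes Q :: "real^'n^'n"
  assumes sym: "\<And>a b. Q $ a $ b = Q $ b $ a" and pos: "\<And>a. Q $ a $ a \<ge> 0" and inv: "invertible Q"
    and reflections: "\<And>j. transpose (reflection_mat (\<lambda>b. of_int (cartan j b)) j) ** Q **
      reflection_mat (\<lambda>b. of_int (cartan j b)) j = Q"
    and dual: "diag_mat (\<lambda>a. of_int (e a)) ** matrix_inv Q ** diag_mat (\<lambda>a. of_int (e a)) = Q"
  shows "Q = block_form scale"
proof -
  define y where "y a = Q $ a $ a / 2" for a
  have row: "Q $ a $ b = y a * of_int (cartan a b)" for a b
    using reflection_mat_invariant_iff[of "\<lambda>b. of_int (cartan a b)" a Q, OF _ sym] reflections[of a]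
    by (simp add: y_def cartan_def[of a a])
  then have Q: "Q = block_form y"
    by (simp add: block_form_def vec_eq_iff)
  \<comment> \<open>Symmetry equates the entries at \<open>(a, r a)\<close> and
    \<open>(r a, a)\<close>, so paired indices share their factor.\<close>
  have y: "y (r a) = y a" for a
    using sym[of a "r a"] unfolding row by (auto simp: cartan_def split: if_splits)
  let ?D = "diag_mat (\<lambda>a. real_of_int (e a))"
  \<comment> \<open>Substituting the duality for the second \<open>Q\<close> lets
    \<open>?D ** ?D\<close> and then \<open>Q\<close> with its inverse cancel.\<close>
  have "Q ** ?D ** Q = Q ** ?D ** (?D ** matrix_inv Q ** ?D)"
    by (simp add: dual)
  also have "\<dots> = Q ** (?D ** ?D) ** matrix_inv Q ** ?D"
    by (simp only: matrix_mul_assoc)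
  also have "\<dots> = ?D"
    by (simp add: diag_e_square matrix_inv_mult inv)
  finally have diag: "diag_mat (\<lambda>a. (if r a = a then 4 else 3) * (y a)\<^sup>2 * of_int (e a)) = ?D"
    unfolding Q by (simp add: block_form_diag y)
  have eq: "(if r a = a then 4 else 3) * (y a)\<^sup>2 * of_int (e a) = real_of_int (e a)" for a
    using arg_cong[OF diag, of "\<lambda>M. M $ a $ a"]
    by (simp only: diag_mat_def vec_lambda_beta refl if_True)
  have "(y a)\<^sup>2 = (scale a)\<^sup>2" for a
  proof -
    have "e a \<noteq> 0"
      using e_square[of a] by auto
    then have "(if r a = a then 4 else 3) * (y a)\<^sup>2 = 1"
      using eq[of a] by (cases "r a = a") simp_all
    then show ?thesis
      by (cases "r a = a") (simp_all add: scale_def power_divide)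
  qed
  moreover have "0 \<le> y a" for a
    using pos[of a] by (simp add: y_def)
  ultimately have "y a = scale a" for a
    using scale_pos by (blast intro: power2_eq_imp_eq less_imp_le)
  then show ?thesis
    by (simp add: Q block_form_def)
qed

section \<open>Values of the form and its systoles\<close>

lemma block_form_scale_quadratic:
  "v \<bullet> (block_form scale *v v)
     = (\<Sum>j\<in>UNIV. if r j = j then (v $ j)\<^sup>2 else ((v $ j)\<^sup>2 + (v $ r j)\<^sup>2 + v $ j * v $ r j) / sqrt 3)"
proof -
  have bij: "bij r"
    by (rule o_bij[of r]) auto
  \<comment> \<open>Used to exchange half of the square terms between partners, so that each pair's
    form is split evenly between its two indices and every summand is nonnegative.\<close>
  have reindex: "(\<Sum>j\<in>UNIV. scale j * (v $ r j)\<^sup>2) = (\<Sum>j\<in>UNIV. scale j * (v $ j)\<^sup>2)"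
    using sum.reindex_bij_betw[OF bij, of "\<lambda>j. scale j * (v $ j)\<^sup>2"] by (simp add: scale_r)
  have "(block_form scale *v v) $ j = scale j * (if r j = j then 2 * v $ j else 2 * v $ j + v $ r j)" for j
    by (simp add: matrix_vector_mult_def block_form_def mult.assoc sum_cartan flip: sum_distrib_left)
  then have "v \<bullet> (block_form scale *v v)
      = (\<Sum>j\<in>UNIV. v $ j * (scale j * (if r j = j then 2 * v $ j else 2 * v $ j + v $ r j)))"
    by (simp add: inner_vec_def)
  also have "\<dots> = (\<Sum>j\<in>UNIV. 2 * (scale j * (v $ j)\<^sup>2) + (if r j = j then 0 else scale j * (v $ j * v $ r j)))"
    by (rule sum.cong) (auto simp: power2_eq_square algebra_simps)
  also have "\<dots> = (\<Sum>j\<in>UNIV. scale j * (v $ j)\<^sup>2 + scale j * (v $ r j)\<^sup>2 +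
      (if r j = j then 0 else scale j * (v $ j * v $ r j)))"
    by (simp add: sum.distrib reindex flip: sum_distrib_left)
  also have "\<dots> = (\<Sum>j\<in>UNIV. if r j = j then (v $ j)\<^sup>2 else
      ((v $ j)\<^sup>2 + (v $ r j)\<^sup>2 + v $ j * v $ r j) / sqrt 3)"
    by (rule sum.cong) (auto simp: scale_def algebra_simps add_divide_distrib)
  finally show ?thesis .
qed

lemma binary_form_bound: "x\<^sup>2 / 2 \<le> x\<^sup>2 + y\<^sup>2 + x * y" for x y :: real
proof -
  have "x\<^sup>2 + y\<^sup>2 + x * y - x\<^sup>2 / 2 = (x\<^sup>2 + y\<^sup>2 + (x + y)\<^sup>2 - x\<^sup>2) / 2"
    by (simp add: power2_eq_square algebra_simps)
  moreover have "\<dots> \<ge> 0"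
    by simp
  ultimately show ?thesis
    by linarith
qed

text \<open>The lower bound that makes the stabilizer finite. The constant is the
  \<open>1 / 2\<close> of the binary form divided by \<open>sqrt 3\<close>; being at most 1, it also
  serves the fixed indices.\<close>

lemma block_form_scale_bound: "1 / (2 * sqrt 3) * (v $ i)\<^sup>2 \<le> v \<bullet> (block_form scale *v v)"
proof -
  let ?w = "\<lambda>j. if r j = j then (v $ j)\<^sup>2 else ((v $ j)\<^sup>2 + (v $ r j)\<^sup>2 + v $ j * v $ r j) / sqrt 3"
  have w: "1 / (2 * sqrt 3) * (v $ j)\<^sup>2 \<le> ?w j" for j
  proof (cases "r j = j")
    case True
    have "(1::real) \<le> sqrt 3" by simp
    then have "1 \<le> 2 * sqrt 3" by linarith
    then have "1 / (2 * sqrt 3) \<le> 1"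
      by (subst divide_le_eq_1_pos) linarith+
    with True show ?thesis
      using mult_right_mono[of "1 / (2 * sqrt 3)" 1 "(v $ j)\<^sup>2"] by simp
  next
    case False
    then show ?thesis
      using divide_right_mono[OF binary_form_bound[of "v $ j" "v $ r j"], of "sqrt 3"]
      by (simp add: field_simps)
  qed
  have "?w i \<le> (\<Sum>j\<in>UNIV. ?w j)"
  proof (rule member_le_sum)
    fix j
    have "0 \<le> 1 / (2 * sqrt 3) * (v $ j)\<^sup>2" by simp
    then show "0 \<le> ?w j" using w[of j] by linarith
  qed auto
  with w[of i] show ?thesis
    unfolding block_form_scale_quadratic by linarith
qed

text \<open>At a nonzero integer pair the form \<open>x^2 + y^2 + x y\<close> is a positive integer,
  hence at least 1, and the pair contributes \<open>2 / sqrt 3\<close> times its value.\<close>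

lemma block_form_scale_int_bound:
  assumes "r i \<noteq> i" "v $ i \<noteq> 0"
  shows "1 < real_vec v \<bullet> (block_form scale *v real_vec v)"
proof -
  let ?I = "\<lambda>j. (v $ j)\<^sup>2 + (v $ r j)\<^sup>2 + v $ j * v $ r j"
  let ?v = "real_vec v"
  let ?w = "\<lambda>j. if r j = j then (?v $ j)\<^sup>2 else ((?v $ j)\<^sup>2 + (?v $ r j)\<^sup>2 + ?v $ j * ?v $ r j) / sqrt 3"
  have "0 \<le> (?v $ j)\<^sup>2 + (?v $ r j)\<^sup>2 + ?v $ j * ?v $ r j" for j
    by (rule order_trans[OF _ binary_form_bound]) simp
  then have nonneg: "0 \<le> ?w j" for j
    by simp
  have I: "?w j = of_int (?I j) / sqrt 3" if "r j \<noteq> j" for j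
    using that by (simp add: real_vec_def)
  have "0 < (?v $ i)\<^sup>2 / 2"
    using assms(2) by (simp add: real_vec_def)
  also have "\<dots> \<le> of_int (?I i)"
    using binary_form_bound[of "?v $ i" "?v $ r i"] by (simp add: real_vec_def)
  finally have "1 \<le> ?I i"
    by linarith
  then have Ii: "1 \<le> real_of_int (?I i)"
    by linarith
  \<comment> \<open>The binary form is symmetric, so the summand at \<open>r i\<close> equals the
    one at \<open>i\<close> and doubles it.\<close>
  have "?I (r i) = ?I i"
    by (simp add: algebra_simps)
  moreover have "r (r i) \<noteq> r i"
    using assms(1) by auto
  ultimately have "?w (r i) = of_int (?I i) / sqrt 3"
    using I[of "r i"] by (simp only: simp_thms if_False)
  moreover note I[OF assms(1)]
  moreover have "1 / sqrt 3 \<le> of_int (?I i) / sqrt 3"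
    using Ii by (intro divide_right_mono) auto
  moreover have "1 < 2 * (1 / sqrt 3)"
    using real_sqrt_less_mono[of 3 4] by (simp add: field_simps)
  ultimately have "1 < ?w i + ?w (r i)"
    by linarith
  also have "\<dots> = (\<Sum>j\<in>{i, r i}. ?w j)"
    using assms(1) by (subst sum.insert) auto
  also have "\<dots> \<le> (\<Sum>j\<in>UNIV. ?w j)"
    using nonneg by (intro sum_mono2) auto
  finally show ?thesis
    unfolding block_form_scale_quadratic .
qed

text \<open>A basis vector at a fixed index has length 1, so a systole is no longer than that and
  must vanish on all paired coordinates. The systoles lie in the span of at most two basis
  vectors.\<close>

lemma dim_systoles:
  assumes "gram A = block_form scale"
  shows "dim (real_vec ` systoles A) \<le> 2"
proof -
  have norm: "(norm (A *v x))\<^sup>2 = x \<bullet> (block_form scale *v x)" for x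
    unfolding assms[symmetric]
    by (simp add: gram_def power2_norm_eq_inner dot_lmul_matrix inner_commute
        flip: matrix_vector_mul_assoc)
      (metis dot_lmul_matrix inner_commute vector_transpose_matrix)
  obtain f where f: "r f = f"
    using fixed_nonempty by auto
  have zero: "v $ i = 0" if v: "v \<in> systoles A" and i: "r i \<noteq> i" for v i
  proof (rule ccontr)
    assume "v $ i \<noteq> 0"
    with i have "1 < real_vec v \<bullet> (block_form scale *v real_vec v)"
      by (rule block_form_scale_int_bound)
    also have "\<dots> \<le> (norm (A *v real_vec (axis f 1)))\<^sup>2"
    proof -
      have "axis f 1 \<noteq> (0 :: int^'n)"
        by (simp add: axis_eq_0_iff)
      then have "norm (A *v real_vec v) \<le> norm (A *v real_vec (axis f 1))"
        using v unfolding systoles_def is_arg_min_def mem_Collect_eq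
        by (meson not_less)
      then show ?thesis
        unfolding norm[symmetric] by (rule power_mono) simp
    qed
    also have "\<dots> = (\<Sum>j\<in>UNIV. if j = f then 1 else 0)"
      unfolding norm block_form_scale_quadratic
      using f by (intro sum.cong) (auto simp: real_vec_def axis_def)
    finally show False by simp
  qed
  have "real_vec v \<in> span ((\<lambda>i. axis i 1) ` {i. r i = i})" if "v \<in> systoles A" for v
  proof -
    have "real_vec v = (\<Sum>i\<in>UNIV. real_vec v $ i *s axis i 1)"
      by (simp add: basis_expansion)
    also have "\<dots> = (\<Sum>i | r i = i. real_vec v $ i *s axis i 1)"
      using zero[OF that] by (intro sum.mono_neutral_right) (auto simp: real_vec_def)
    also have "\<dots> \<in> span ((\<lambda>i. axis i 1) ` {i. r i = i})"
      unfolding scalar_mult_eq_scaleR by (intro span_sum span_scale span_base) auto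
    finally show ?thesis .
  qed
  then have "dim (real_vec ` systoles A) \<le> card ((\<lambda>i. axis i 1 :: real^'n) ` {i. r i = i})"
    by (intro dim_le_card) auto
  also have "\<dots> \<le> card {i. r i = i}"
    by (rule card_image_le) simp
  finally show ?thesis
    using card_fixed by linarith
qed

lemma block_form_scale_notin: "block_form scale \<notin> lattices_with_systole_rank_ge 3"
proof
  assume "block_form scale \<in> lattices_with_systole_rank_ge 3"
  then obtain A where "block_form scale = gram A" "3 \<le> dim (real_vec ` systoles A)"
    by (auto simp: lattices_with_systole_rank_ge_def)
  then show False
    using dim_systoles[of A] by simp
qed

text \<open>The reflections in the basis vectors and the sign matrix composed with
  \<open>sigma_aut\<close> belong to the stabilizer; being fixed by them is what the uniqueness of
  the block form asks for.\<close>

lemma fixed_point_form_stabilizer: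
  assumes card: "3 \<le> CARD('n)" and det: "det A = 1"
    and fixed: "\<And>\<phi>. \<phi> \<in> form_stabilizer (block_form scale) \<Longrightarrow> aut_act \<phi> (gram A) = gram A"
  shows "gram A = block_form scale"
proof (rule block_form_unique)
  let ?f = "\<lambda>j b. real_of_int (cartan j b)"
  let ?D = "diag_mat (\<lambda>a. real_of_int (e a))"
  \<comment> \<open>All matrices used are their own inverses, so the inverse in
    \<open>conj_act\<close> disappears and the action is congruence by the matrix itself.\<close>
  have involution: "invertible \<gamma> \<and> conj_act \<gamma> Q = transpose (map_matrix of_int \<gamma>) ** Q ** map_matrix of_int \<gamma>"
    if "\<gamma> ** \<gamma> = mat 1" for \<gamma> :: "int^'n^'n" and Q
    using matrix_inv_eqI[OF that that] that by (auto simp: conj_act_def invertible_def)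
  show sym: "gram A $ a $ b = gram A $ b $ a" for a b
    by (simp add: gram_def matrix_matrix_mult_def transpose_def mult.commute)
  show "gram A $ a $ a \<ge> 0" for a
    by (simp add: gram_def matrix_matrix_mult_def transpose_def sum_nonneg)
  show "invertible (gram A)"
    by (simp add: invertible_det_nz gram_def det_mul det)
  show "transpose (reflection_mat (?f j) j) ** gram A ** reflection_mat (?f j) j = gram A" for j
  proof -
    let ?\<gamma> = "reflection_mat (cartan j) j"
    have \<gamma>: "invertible ?\<gamma>" "conj_act ?\<gamma> Q = transpose (reflection_mat (?f j) j) ** Q ** reflection_mat (?f j) j" for Q
      using involution[OF reflection_mat_square[of "cartan j" j]]
      by (simp_all add: cartan_def map_of_int_reflection_mat)
    \<comment> \<open>Row \<open>j\<close> of the form is \<open>scale j\<close> times the linear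
      form of the reflection, which is the criterion for invariance.\<close>
    have "transpose (reflection_mat (?f j) j) ** block_form scale ** reflection_mat (?f j) j = block_form scale"
      using reflection_mat_invariant_iff[of "?f j" j "block_form scale", OF _ block_form_sym[of scale, OF scale_r]]
      by (simp add: block_form_def cartan_def)
    then have "conj_aut ?\<gamma> \<in> form_stabilizer (block_form scale)"
      using \<gamma> by (auto simp: form_stabilizer_def form_maps_def map_of_int_reflection_mat)
    from fixed[OF this] show ?thesis
      using \<gamma> card by (simp add: aut_act_conj_aut)
  qed
  show "?D ** matrix_inv (gram A) ** ?D = gram A"
  proof -
    have D: "invertible (diag_mat e)" "conj_act (diag_mat e) Q = ?D ** Q ** ?D" for Q
      using involution[OF diag_e_square(1)] by (simp_all add: map_of_int_diag_mat transpose_diag_mat)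
    have "diag_mat e \<in> form_maps (block_form scale) (matrix_inv (block_form scale))"
      using D by (simp add: form_maps_def map_of_int_diag_mat transpose_diag_mat matrix_inv_block_form_scale)
    then have "compose (carrier SL_int) (conj_aut (diag_mat e)) sigma_aut \<in> form_stabilizer (block_form scale)"
      by (auto simp: form_stabilizer_def)
    from fixed[OF this] show ?thesis
      using D card by (simp add: aut_act_conj_aut_sigma)
  qed
qed

lemma block_form_scale_stabilizer:
  "subgroup (form_stabilizer (block_form scale)) (AutoGroup SL_int)"
  "finite (form_stabilizer (block_form scale))"
  using form_stabilizer_subgroup[OF matrix_inv_block_form_scale(1)]
    finite_form_maps[OF _ block_form_scale_bound] by auto

end

theorem theorem1p2:
  assumes "3 \<le> CARD('n::finite)"
  shows "\<not> (\<exists>W :: (real^'n^'n) set.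
           W \<subseteq> lattices_with_systole_rank_ge 3 \<and>
           (\<forall>\<phi>\<in>carrier (AutoGroup SL_int). \<forall>Q\<in>W. aut_act \<phi> Q \<in> W) \<and>
           is_model_for_EG (AutoGroup SL_int) aut_act (subtopology (top_of_set lattice_space) W))"
proof
  assume "\<exists>W :: (real^'n^'n) set.
           W \<subseteq> lattices_with_systole_rank_ge 3 \<and>
           (\<forall>\<phi>\<in>carrier (AutoGroup SL_int). \<forall>Q\<in>W. aut_act \<phi> Q \<in> W) \<and>
           is_model_for_EG (AutoGroup SL_int) aut_act (subtopology (top_of_set lattice_space) W)"
  then obtain W :: "(real^'n^'n) set" where W: "W \<subseteq> lattices_with_systole_rank_ge 3"
    and model: "is_model_for_EG (AutoGroup SL_int) aut_act (subtopology (top_of_set lattice_space) W)"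
    by blast
  obtain r :: "'n \<Rightarrow> 'n" and e where "pairing r e"
    using exists_pairing[where 'n = 'n] unfolding pairing_def by blast
  then interpret pairing r e .
  \<comment> \<open>The stabilizer is a finite subgroup, so a model contains a point fixed by it;
    that point can only be \<open>block_form scale\<close>.\<close>
  have "fixed_points aut_act (subtopology (top_of_set lattice_space) W)
      (form_stabilizer (block_form scale)) \<noteq> {}"
    using model block_form_scale_stabilizer unfolding is_model_for_EG_def by auto
  then obtain Q where "Q \<in> W" and fixed: "\<And>\<phi>. \<phi> \<in> form_stabilizer (block_form scale) \<Longrightarrow> aut_act \<phi> Q = Q"
    by (auto simp: fixed_points_def)
  then have Q: "Q \<in> lattices_with_systole_rank_ge 3"
    using W by blast
  then obtain A where "det A = 1" "Q = gram A"
    by (auto simp: lattices_with_systole_rank_ge_def)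
  then have "Q = block_form scale"
    using fixed_point_form_stabilizer[OF assms] fixed by simp
  with Q show False
    using block_form_scale_notin by simp
qed

end
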